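(* There is a set $E\subset(0,\infty)^4$ of Hausdorff dimension at most $4-\tfrac13$ (that is, of codimension at least $\tfrac13$) such that for every choice of channel coefficients $\mathbf h=(h_{11},h_{12},h_{21},h_{22})\in(0,\infty)^4\setminus E$, the total degrees of freedom of the two-user real Gaussian $X$-channel with channel coefficients $h_{ij}$ $(i,j=1,2)$ equals $\tfrac43$.
   Context: Two-user real Gaussian $X$-channel with coefficients $h_{ij}>0$: at each time $t$, transmitter $j\in\{1,2\}$ sends $x_j(t)\in\mathbb{R}$ and receiver $i\in\{1,2\}$ observes $y_i(t)=h_{i1}x_1(t)+h_{i2}x_2(t)+z_i(t)$, where the $z_i(t)$ are i.i.d. $\mathcal N(0,1)$, independent of everything else. For $i,j\in\{1,2\}$, transmitter $j$ holds a message $W_{ij}$ intended for receiver $i$; the four messages are independent and uniform on sets of size $\lceil 2^{NR_{ij}}\rceil$. A code of block length $N$ with power $P$ consists of encoders mapping $(W_{1j},W_{2j})$ to $(x_j(1),\dots,x_j(N))$ with $\sum_{t=1}^N x_j(t)^2\le NP$, and decoders at receiver $i$ mapping $(y_i(1),\dots,y_i(N))$ to estimates of $(W_{i1},W_{i2})$. A rate tuple $(R_{ij})$ is achievable at power $P$ if there are such codes with $N\to\infty$ whose probability of decoding error tends to $0$. Let $C_\Sigma(P)$ be the supremum of $R_{11}+R_{12}+R_{21}+R_{22}$ over achievable tuples. The total degrees of freedom (DoF) is $\limsup_{P\to\infty} C_\Sigma(P)/(\tfrac12\log_2 P)$. Hausdorff dimension is the standard notion. *)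

theory Defs
  imports "HOL-Probability.Probability"
begin

text \<open>
  The weight of a covering set is its diameter to the power \<open>s\<close>. The case distinction fixes the
  usual conventions: the empty set weighs 0, and a nonempty set weighs 1 if \<open>s = 0\<close>
  (whereas \<open>0 powr 0 = 0\<close> in the library). The boundedness condition on covers is needed because
  the library's \<open>diameter\<close> is only meaningful on bounded sets.
\<close>

definition hausdorff_weight :: "real \<Rightarrow> 'a::metric_space set \<Rightarrow> ennreal" where
  "hausdorff_weight s U =
     (if U = {} then 0 else if s = 0 then 1 else ennreal (diameter U powr s))"

definition delta_covers :: "real \<Rightarrow> 'a::metric_space set \<Rightarrow> (nat \<Rightarrow> 'a set) set" where
  "delta_covers \<delta> S = {U. S \<subseteq> (\<Union>n. U n) \<and> (\<forall>n. bounded (U n) \<and> diameter (U n) \<le> \<delta>)}"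

definition hausdorff_premeasure :: "real \<Rightarrow> real \<Rightarrow> 'a::metric_space set \<Rightarrow> ennreal" where
  "hausdorff_premeasure s \<delta> S = (INF U\<in>delta_covers \<delta> S. \<Sum>n. hausdorff_weight s (U n))"

definition hausdorff_measure :: "real \<Rightarrow> 'a::metric_space set \<Rightarrow> ennreal" where
  "hausdorff_measure s S = (SUP \<delta>\<in>{0<..}. hausdorff_premeasure s \<delta> S)"

definition hausdorff_dim :: "'a::metric_space set \<Rightarrow> ereal" where
  "hausdorff_dim S = (INF s\<in>{s. 0 \<le> s \<and> hausdorff_measure s S = 0}. ereal s)"

text \<open>
  The index type \<open>2\<close> has the two elements \<open>1\<close> and \<open>2\<close>. A coefficient matrix \<open>h\<close> has \<open>h $ i $ j\<close> as
  the gain from transmitter \<open>j\<close> to receiver \<open>i\<close>; the metric on \<open>real^2^2\<close> is the Euclidean metric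
  of the four entries. Messages and rates are likewise indexed by receiver, then transmitter.
  Channel uses are numbered \<open>0, \<dots>, N - 1\<close>.
\<close>

definition num_messages :: "nat \<Rightarrow> real \<Rightarrow> nat" where
  "num_messages N r = nat \<lceil>2 powr (real N * r)\<rceil>"

definition messages :: "nat \<Rightarrow> (2 \<Rightarrow> 2 \<Rightarrow> real) \<Rightarrow> (2 \<Rightarrow> 2 \<Rightarrow> nat) set" where
  "messages N R = {W. \<forall>i j. W i j < num_messages N (R i j)}"

type_synonym encoders = "2 \<Rightarrow> nat \<times> nat \<Rightarrow> nat \<Rightarrow> real"
type_synonym decoders = "2 \<Rightarrow> (nat \<Rightarrow> real) \<Rightarrow> nat \<times> nat"

text \<open>
  \<open>enc j (W 1 j, W 2 j) t\<close> is the symbol sent by transmitter \<open>j\<close> at time \<open>t\<close>, and \<open>dec i y\<close> is the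
  estimate of \<open>(W i 1, W i 2)\<close> that receiver \<open>i\<close> forms from its received block \<open>y\<close>.
  Decoders are measurable, so that the probability of error makes sense.
\<close>

definition X_code ::
    "nat \<Rightarrow> real \<Rightarrow> (2 \<Rightarrow> 2 \<Rightarrow> real) \<Rightarrow> encoders \<Rightarrow> decoders \<Rightarrow> bool" where
  "X_code N P R enc dec \<longleftrightarrow>
     (\<forall>W\<in>messages N R. \<forall>j. (\<Sum>t<N. (enc j (W 1 j, W 2 j) t)\<^sup>2) \<le> real N * P) \<and>
     (\<forall>i. dec i \<in> PiM {..<N} (\<lambda>_. borel) \<rightarrow>\<^sub>M count_space UNIV)"

definition received ::
    "real^2^2 \<Rightarrow> nat \<Rightarrow> encoders \<Rightarrow> (2 \<Rightarrow> 2 \<Rightarrow> nat) \<Rightarrow> (2 \<times> nat \<Rightarrow> real) \<Rightarrow> 2 \<Rightarrow> nat \<Rightarrow> real" where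
  "received h N enc W z i =
     (\<lambda>t\<in>{..<N}. (\<Sum>j\<in>UNIV. h $ i $ j * enc j (W 1 j, W 2 j) t) + z (i, t))"

definition noise :: "nat \<Rightarrow> (2 \<times> nat \<Rightarrow> real) measure" where
  "noise N = PiM (UNIV \<times> {..<N}) (\<lambda>_. density lborel std_normal_density)"

definition message_noise_space ::
    "nat \<Rightarrow> (2 \<Rightarrow> 2 \<Rightarrow> real) \<Rightarrow> ((2 \<Rightarrow> 2 \<Rightarrow> nat) \<times> (2 \<times> nat \<Rightarrow> real)) measure" where
  "message_noise_space N R = measure_pmf (pmf_of_set (messages N R)) \<Otimes>\<^sub>M noise N"

definition error_event ::
    "real^2^2 \<Rightarrow> nat \<Rightarrow> (2 \<Rightarrow> 2 \<Rightarrow> real) \<Rightarrow> encoders \<Rightarrow> decoders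
      \<Rightarrow> ((2 \<Rightarrow> 2 \<Rightarrow> nat) \<times> (2 \<times> nat \<Rightarrow> real)) set" where
  "error_event h N R enc dec =
     {(W, z) \<in> space (message_noise_space N R).
        \<exists>i. dec i (received h N enc W z i) \<noteq> (W i 1, W i 2)}"

definition error_prob ::
    "real^2^2 \<Rightarrow> nat \<Rightarrow> (2 \<Rightarrow> 2 \<Rightarrow> real) \<Rightarrow> encoders \<Rightarrow> decoders \<Rightarrow> real" where
  "error_prob h N R enc dec = measure (message_noise_space N R) (error_event h N R enc dec)"

definition achievable :: "real^2^2 \<Rightarrow> real \<Rightarrow> (2 \<Rightarrow> 2 \<Rightarrow> real) \<Rightarrow> bool" where
  "achievable h P R \<longleftrightarrow>
     (\<forall>i j. 0 \<le> R i j) \<and>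
     (\<exists>N enc dec.
        filterlim N at_top sequentially \<and>
        (\<forall>k::nat. X_code (N k) P R (enc k) (dec k)) \<and>
        (\<lambda>k. error_prob h (N k) R (enc k) (dec k)) \<longlonglongrightarrow> 0)"

definition sum_capacity :: "real^2^2 \<Rightarrow> real \<Rightarrow> ereal" where
  "sum_capacity h P = (SUP R\<in>{R. achievable h P R}. ereal (\<Sum>i\<in>UNIV. \<Sum>j\<in>UNIV. R i j))"

definition total_dof :: "real^2^2 \<Rightarrow> ereal" where
  "total_dof h = Limsup at_top (\<lambda>P. sum_capacity h P / ereal (1 / 2 * log 2 P))"

text \<open>
  Sanity checks: the message set is finite and nonempty, so that \<open>pmf_of_set\<close> is the uniform
  distribution on it, and the error event of a code is measurable in a probability space.
\<close>

lemma messages_finite_nonempty: "finite (messages N R)" "messages N R \<noteq> {}"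
proof -
  have "messages N R = (\<Pi>\<^sub>E i\<in>UNIV. \<Pi>\<^sub>E j\<in>UNIV. {..<num_messages N (R i j)})"
    by (auto simp: messages_def PiE_UNIV_domain Pi_def)
  then show "finite (messages N R)"
    by (simp add: finite_PiE)
  have "(\<lambda>_ _. 0) \<in> messages N R"
    by (simp add: messages_def num_messages_def)
  then show "messages N R \<noteq> {}" by blast
qed

lemma prob_space_message_noise: "prob_space (message_noise_space N R)"
proof -
  interpret noise: prob_space "noise N"
    unfolding noise_def by (intro prob_space_PiM prob_space_normal_density) simp
  interpret pair_prob_space "measure_pmf (pmf_of_set (messages N R))" "noise N" ..
  show ?thesis
    unfolding message_noise_space_def by (rule prob_space_axioms)
qed

lemma error_event_measurable:
  assumes "X_code N P R enc dec"
  shows "error_event h N R enc dec \<in> sets (message_noise_space N R)"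
proof -
  have dec: "dec i \<in> PiM {..<N} (\<lambda>_. borel) \<rightarrow>\<^sub>M count_space UNIV" for i
    using assms by (auto simp: X_code_def)
  have rec: "(\<lambda>z. received h N enc W z i) \<in> noise N \<rightarrow>\<^sub>M PiM {..<N} (\<lambda>_. borel)" for W i
    unfolding received_def noise_def by measurable
  have "(\<lambda>z. dec i (received h N enc W z i)) \<in> noise N \<rightarrow>\<^sub>M count_space UNIV" for W i
    using measurable_compose[OF rec dec] .
  then have 1: "{z \<in> space (noise N). dec i (received h N enc W z i) \<noteq> (W i 1, W i 2)}
      \<in> sets (noise N)" for W i
    by measurable
  have *: "{z \<in> space (noise N). \<exists>i. dec i (received h N enc W z i) \<noteq> (W i 1, W i 2)}
      \<in> sets (noise N)" for W
  proof -
    have "{z \<in> space (noise N). \<exists>i. dec i (received h N enc W z i) \<noteq> (W i 1, W i 2)} =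
        (\<Union>i. {z \<in> space (noise N). dec i (received h N enc W z i) \<noteq> (W i 1, W i 2)})"
      by auto
    then show ?thesis using 1 by (simp add: sets.finite_UN)
  qed
  have count: "countable (UNIV :: (2 \<Rightarrow> 2 \<Rightarrow> nat) set)"
  proof -
    have "countable (\<Pi>\<^sub>E i\<in>(UNIV :: 2 set). \<Pi>\<^sub>E j\<in>(UNIV :: 2 set). (UNIV :: nat set))"
      by (intro countable_PiE) auto
    then show ?thesis by (simp add: PiE_UNIV_domain)
  qed
  have "error_event h N R enc dec = (\<Union>W. {W} \<times>
      {z \<in> space (noise N). \<exists>i. dec i (received h N enc W z i) \<noteq> (W i 1, W i 2)})"
    by (auto simp: error_event_def message_noise_space_def space_pair_measure)
  also have "\<dots> \<in> sets (message_noise_space N R)"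
    unfolding message_noise_space_def
    by (intro sets.countable_UN'' pair_measureI * count) auto
  finally show ?thesis .
qed

end

theory Submission
  imports Defs "HOL-Real_Asymp.Real_Asymp"
begin

text \<open>
  The exceptional set consists of the channels with rational cross ratio
  \<open>\<rho> = h12 h21 / (h11 h22)\<close>, a countable union of smooth hypersurfaces of dimension 3.

  Converse (for every channel): if one message \<open>W_i'j'\<close> is fixed, then receiver \<open>i\<close> decodes its two
  messages, removes the signal of transmitter \<open>j'\<close>, and can then simulate receiver \<open>i'\<close> up to a bounded
  change of the noise power. So any three messages are decodable from one Gaussian channel and have sum rate
  at most \<open>1/2 log P + O(1)\<close>; the four such bounds add up to \<open>4/3\<close>. The point-to-point bound comes from
  comparing each noise density pointwise with one wide Gaussian, for which the decoding regions have
  total mass at most 1.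

  Achievability: integer symbols below \<open>Q\<close> are precoded so that at each receiver the two interfering
  signals have the same coefficient. One of the two groups of symbols carries a free real scale \<open>s\<close>.
  For irrational \<open>\<rho>\<close> there are infinitely many \<open>Q\<close> with \<open>|a + \<rho> b| \<ge> 1/(2Q)\<close> for all nonzero \<open>|a|, |b| < Q\<close>,
  and for such \<open>Q\<close> a measure count yields an \<open>s \<in> [1,2]\<close>
  for which both receivers see points that are \<open>c/Q^2\<close> apart. After amplification by \<open>Q^2\<close> the power
  is of order \<open>Q^6\<close>, while four streams of rate \<open>log Q\<close> are carried, up to a small loss for an
  outer code that corrects the rare symbol errors. Infinitely many \<open>Q\<close> suffice because the degrees of freedom are
  defined by a limsup.
\<close>

section \<open>Gaussian product measures\<close>

abbreviation std_gauss :: "real measure" where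
  "std_gauss \<equiv> density lborel (\<lambda>x. ennreal (std_normal_density x))"

abbreviation gauss :: "'i set \<Rightarrow> ('i \<Rightarrow> real) measure" where
  "gauss I \<equiv> PiM I (\<lambda>_. std_gauss)"

lemma prob_space_std_gauss: "prob_space std_gauss"
  by (intro prob_space_normal_density) simp

lemma prob_space_gauss: "prob_space (gauss I)"
  by (intro prob_space_PiM prob_space_std_gauss)

lemma product_sigma_finite_std_gauss: "product_sigma_finite (\<lambda>_. std_gauss)"
  unfolding product_sigma_finite_def
  using prob_space_imp_sigma_finite[OF prob_space_std_gauss] by simp

lemma sets_gauss [measurable_cong]: "sets (gauss I) = sets (PiM I (\<lambda>_. borel))"
  by (intro sets_PiM_cong) auto

text \<open>Rescaling turns the two variables into independent centred normals with deviations
  \<open>a\<close> and \<open>b\<close>; their densities convolve to the standard one because the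
  variances add up to 1.\<close>

lemma gauss_rotation_1:
  assumes ab: "0 < a" "0 < b" "a\<^sup>2 + b\<^sup>2 = (1::real)" and [measurable]: "f \<in> borel_measurable borel"
  shows "(\<integral>\<^sup>+ y. \<integral>\<^sup>+ y'. f (a * y + b * y') \<partial>std_gauss \<partial>std_gauss) = (\<integral>\<^sup>+ y. f y \<partial>std_gauss)"
proof -
  have scale: "normal_density 0 c x = std_normal_density (x / c) / c" if "0 < c" for c x :: real
    using that unfolding std_normal_density_def normal_density_def
    by (simp add: real_sqrt_mult power_divide)
  have sub: "(\<integral>\<^sup>+ x. ennreal (std_normal_density x) * g (c * x) \<partial>lborel) =
      (\<integral>\<^sup>+ x. ennreal (normal_density 0 c x) * g x \<partial>lborel)"
    if c: "0 < c" and [measurable]: "g \<in> borel_measurable borel" for c :: real and g :: "real \<Rightarrow> ennreal"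
  proof -
    have "(\<integral>\<^sup>+ x. ennreal (normal_density 0 c x) * g x \<partial>lborel) =
        (\<integral>\<^sup>+ x. ennreal (std_normal_density (x / c)) * (ennreal (1 / c) * g x) \<partial>lborel)"
    proof (intro nn_integral_cong)
      fix x
      have "normal_density 0 c x = std_normal_density (x / c) * (1 / c)" using scale[OF c, of x] by simp
      then show "ennreal (normal_density 0 c x) * g x = ennreal (std_normal_density (x / c)) * (ennreal (1 / c) * g x)"
        using c by (simp only: ennreal_mult' normal_density_nonneg mult.assoc)
    qed
    also have "\<dots> = ennreal \<bar>c\<bar> * (\<integral>\<^sup>+ x. ennreal (std_normal_density ((0 + c * x) / c)) *
        (ennreal (1 / c) * g (0 + c * x)) \<partial>lborel)"
      using c by (intro nn_integral_real_affine) auto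
    also have "\<dots> = (\<integral>\<^sup>+ x. ennreal c * (ennreal (std_normal_density x) * (ennreal (1 / c) * g (c * x))) \<partial>lborel)"
      using c by (subst nn_integral_cmult) auto
    also have "\<dots> = (\<integral>\<^sup>+ x. ennreal (std_normal_density x) * g (c * x) \<partial>lborel)"
    proof (intro nn_integral_cong)
      fix x
      have "ennreal c * (ennreal (std_normal_density x) * (ennreal (1 / c) * g (c * x))) =
        (ennreal c * ennreal (1 / c)) * (ennreal (std_normal_density x) * g (c * x))"
        by (simp add: ac_simps)
      also have "ennreal c * ennreal (1 / c) = 1"
        using c by (simp flip: ennreal_mult')
      finally show "ennreal c * (ennreal (std_normal_density x) * (ennreal (1 / c) * g (c * x))) =
          ennreal (std_normal_density x) * g (c * x)" by simp
    qed
    finally show ?thesis by simp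
  qed
  have shift: "(\<integral>\<^sup>+ y. ennreal (normal_density 0 b y) * f (w + y) \<partial>lborel) =
      (\<integral>\<^sup>+ u. ennreal (normal_density 0 b (u - w)) * f u \<partial>lborel)" for w
    by (subst (2) nn_integral_real_affine[where c = 1 and t = w]) auto
  have "(\<integral>\<^sup>+ y. \<integral>\<^sup>+ y'. f (a * y + b * y') \<partial>std_gauss \<partial>std_gauss) =
      (\<integral>\<^sup>+ y. ennreal (std_normal_density y) *
        (\<integral>\<^sup>+ y'. ennreal (std_normal_density y') * f (a * y + b * y') \<partial>lborel) \<partial>lborel)"
    by (simp add: nn_integral_density)
  also have "\<dots> = (\<integral>\<^sup>+ y. ennreal (std_normal_density y) *
        (\<integral>\<^sup>+ y'. ennreal (normal_density 0 b y') * f (a * y + y') \<partial>lborel) \<partial>lborel)"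
    using sub[OF ab(2), of "\<lambda>z. f (a * _ + z)"] by simp
  also have "\<dots> = (\<integral>\<^sup>+ y. ennreal (normal_density 0 a y) *
        (\<integral>\<^sup>+ y'. ennreal (normal_density 0 b y') * f (y + y') \<partial>lborel) \<partial>lborel)"
    using sub[OF ab(1), of "\<lambda>z. \<integral>\<^sup>+ y'. ennreal (normal_density 0 b y') * f (z + y') \<partial>lborel"] by simp
  also have "\<dots> = (\<integral>\<^sup>+ y. (\<integral>\<^sup>+ u. ennreal (normal_density 0 a y) * (ennreal (normal_density 0 b (u - y)) * f u) \<partial>lborel) \<partial>lborel)"
    unfolding shift by (subst nn_integral_cmult) auto
  also have "\<dots> = (\<integral>\<^sup>+ u. (\<integral>\<^sup>+ y. ennreal (normal_density 0 a y) * (ennreal (normal_density 0 b (u - y)) * f u) \<partial>lborel) \<partial>lborel)"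
    by (intro lborel_pair.Fubini') auto
  also have "\<dots> = (\<integral>\<^sup>+ u. (\<integral>\<^sup>+ y. ennreal (normal_density 0 b (u - y) * normal_density 0 a y) \<partial>lborel) * f u \<partial>lborel)"
    by (subst nn_integral_multc[symmetric]) (auto simp: ennreal_mult' ac_simps)
  also have "\<dots> = (\<integral>\<^sup>+ u. ennreal (std_normal_density u) * f u \<partial>lborel)"
    using fun_cong[OF conv_normal_density_zero_mean[OF ab(2,1)]] ab(3) by (simp add: add.commute)
  finally show ?thesis by (simp add: nn_integral_density)
qed

text \<open>Splits a noise block into two independent blocks of smaller power. The converse makes
  one of the two common to both receivers.\<close>

lemma gauss_rotation:
  assumes "finite I" and ab: "0 < a" "0 < b" "a\<^sup>2 + b\<^sup>2 = (1::real)"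
    and "f \<in> borel_measurable (PiM I (\<lambda>_. borel))"
  shows "(\<integral>\<^sup>+ x. \<integral>\<^sup>+ x'. f (\<lambda>i\<in>I. a * x i + b * x' i) \<partial>gauss I \<partial>gauss I) = (\<integral>\<^sup>+ x. f x \<partial>gauss I)"
  using assms(1,5)
proof (induction I arbitrary: f rule: finite_induct)
  case empty
  interpret product_sigma_finite "\<lambda>_. std_gauss" by (rule product_sigma_finite_std_gauss)
  show ?case by (simp add: PiM_empty nn_integral_count_space_finite restrict_def)
next
  case (insert i I)
  note [measurable] = insert.prems
  interpret product_sigma_finite "\<lambda>_. std_gauss" by (rule product_sigma_finite_std_gauss)
  interpret G: prob_space "gauss I" by (rule prob_space_gauss)
  interpret G': prob_space "gauss (insert i I)" by (rule prob_space_gauss)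
  interpret P: pair_sigma_finite "gauss I" std_gauss
    by (intro pair_sigma_finite.intro prob_space_imp_sigma_finite prob_space_gauss prob_space_std_gauss)
  have upd: "(\<lambda>j\<in>insert i I. a * (x(i := y)) j + b * (x'(i := y')) j) =
      (\<lambda>j\<in>I. a * x j + b * x' j)(i := a * y + b * y')" for x x' y y'
    using insert.hyps by (intro ext) (simp add: restrict_def)
  have inner: "(\<integral>\<^sup>+ x'. f (\<lambda>j\<in>insert i I. w j + b * x' j) \<partial>gauss (insert i I)) =
      (\<integral>\<^sup>+ x'. \<integral>\<^sup>+ y'. f (\<lambda>j\<in>insert i I. w j + b * (x'(i := y')) j) \<partial>std_gauss \<partial>gauss I)" for w
    by (intro product_nn_integral_insert insert.hyps) measurable
  have "(\<integral>\<^sup>+ x. \<integral>\<^sup>+ x'. f (\<lambda>j\<in>insert i I. a * x j + b * x' j) \<partial>gauss (insert i I) \<partial>gauss (insert i I)) =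
      (\<integral>\<^sup>+ x. \<integral>\<^sup>+ y. \<integral>\<^sup>+ x'. \<integral>\<^sup>+ y'. f ((\<lambda>j\<in>I. a * x j + b * x' j)(i := a * y + b * y'))
        \<partial>std_gauss \<partial>gauss I \<partial>std_gauss \<partial>gauss I)"
    unfolding upd[symmetric] inner[symmetric]
    by (intro product_nn_integral_insert insert.hyps) measurable
  \<comment> \<open>The new coordinate of the first copy moves past the old coordinates of the
    second, so that the one-dimensional rotation acts on the two innermost integrals.\<close>
  also have "\<dots> = (\<integral>\<^sup>+ x. \<integral>\<^sup>+ x'. \<integral>\<^sup>+ y. \<integral>\<^sup>+ y'. f ((\<lambda>j\<in>I. a * x j + b * x' j)(i := a * y + b * y'))
        \<partial>std_gauss \<partial>std_gauss \<partial>gauss I \<partial>gauss I)"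
    by (intro nn_integral_cong P.Fubini') measurable
  also have "\<dots> = (\<integral>\<^sup>+ x. \<integral>\<^sup>+ x'. \<integral>\<^sup>+ y. f ((\<lambda>j\<in>I. a * x j + b * x' j)(i := y))
        \<partial>std_gauss \<partial>gauss I \<partial>gauss I)"
    by (intro nn_integral_cong gauss_rotation_1[OF ab]) measurable
  also have "\<dots> = (\<integral>\<^sup>+ x. \<integral>\<^sup>+ y. f (x(i := y)) \<partial>std_gauss \<partial>gauss I)"
    by (intro insert.IH) measurable
  also have "\<dots> = (\<integral>\<^sup>+ x. f x \<partial>gauss (insert i I))"
    using insert.hyps by (simp add: product_nn_integral_insert)
  finally show ?case .
qed

text \<open>The exponent comes from \<open>(c + k x)\<^sup>2 \<le> 2 c\<^sup>2 + 2 (k x)\<^sup>2\<close>.\<close>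

lemma gauss_domination_1:
  assumes k: "0 < k" and r: "0 < r" "2 * k\<^sup>2 \<le> r\<^sup>2" and [measurable]: "f \<in> borel_measurable borel"
  shows "(\<integral>\<^sup>+ x. f (c + k * x) \<partial>std_gauss) \<le> ennreal (r / k * exp (c\<^sup>2 / r\<^sup>2)) * (\<integral>\<^sup>+ x. f (r * x) \<partial>std_gauss)"
proof -
  define q where "q = r / k"
  have q: "0 < q" "2 \<le> q\<^sup>2" "k * q = r"
    using k r by (auto simp: q_def power_divide field_simps)
  \<comment> \<open>The substitution \<open>x = - c / k + q * x'\<close> turns
    \<open>c + k * x\<close> into \<open>r * x'\<close>, with Jacobian \<open>q\<close>; only the
    two density values remain to be compared.\<close>
  have sub: "std_normal_density (- c / k + q * x) \<le> exp (c\<^sup>2 / r\<^sup>2) * std_normal_density x" for x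
  proof -
    define u where "u = - c / k + q * x"
    have xu: "x = (u + c / k) / q" using q by (simp add: u_def)
    have cr: "c\<^sup>2 / r\<^sup>2 = (c / k)\<^sup>2 / q\<^sup>2" using k r by (simp add: q_def power_divide)
    have "x\<^sup>2 = (u + c / k)\<^sup>2 / q\<^sup>2" unfolding xu by (simp add: power_divide)
    also have "\<dots> \<le> (2 * u\<^sup>2 + 2 * (c / k)\<^sup>2) / q\<^sup>2"
      using sum_squares_bound[of u "c/k"] by (intro divide_right_mono) (auto simp: power2_sum)
    also have "\<dots> = u\<^sup>2 * (2 / q\<^sup>2) + 2 * (c\<^sup>2 / r\<^sup>2)" unfolding cr by (simp add: add_divide_distrib)
    also have "\<dots> \<le> u\<^sup>2 * 1 + 2 * (c\<^sup>2 / r\<^sup>2)"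
      using q by (intro add_mono mult_left_mono) (auto simp: field_simps)
    finally have "- u\<^sup>2 / 2 \<le> c\<^sup>2 / r\<^sup>2 + - x\<^sup>2 / 2" by simp
    then have "exp (- u\<^sup>2 / 2) \<le> exp (c\<^sup>2 / r\<^sup>2) * exp (- x\<^sup>2 / 2)" by (simp flip: exp_add)
    then show ?thesis
      unfolding std_normal_density_def u_def[symmetric] by (simp add: divide_right_mono)
  qed
  have "(\<integral>\<^sup>+ x. f (c + k * x) \<partial>std_gauss) = (\<integral>\<^sup>+ x. ennreal (std_normal_density x) * f (c + k * x) \<partial>lborel)"
    by (simp add: nn_integral_density)
  also have "\<dots> = ennreal \<bar>q\<bar> * (\<integral>\<^sup>+ x. ennreal (std_normal_density (- c / k + q * x)) *
      f (c + k * (- c / k + q * x)) \<partial>lborel)"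
    using q by (intro nn_integral_real_affine) auto
  also have "\<dots> \<le> ennreal q * (\<integral>\<^sup>+ x. ennreal (exp (c\<^sup>2 / r\<^sup>2)) * (ennreal (std_normal_density x) * f (r * x)) \<partial>lborel)"
  proof -
    have "c + k * (- c / k + q * x) = c + (k * (- c / k) + (k * q) * x)" for x
      by (simp only: distrib_left mult.assoc)
    then have "c + k * (- c / k + q * x) = r * x" for x using k q(3) by simp
    moreover have "ennreal (std_normal_density (- c / k + q * x)) \<le> ennreal (exp (c\<^sup>2 / r\<^sup>2)) * ennreal (std_normal_density x)" for x
      using sub[of x] by (simp flip: ennreal_mult' add: ennreal_leI)
    ultimately show ?thesis using q
      by (auto intro!: mult_left_mono nn_integral_mono mult_right_mono simp flip: mult.assoc)
  qed
  also have "\<dots> = ennreal q * (ennreal (exp (c\<^sup>2 / r\<^sup>2)) * (\<integral>\<^sup>+ x. f (r * x) \<partial>std_gauss))"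
    by (simp add: nn_integral_cmult nn_integral_density)
  also have "\<dots> = ennreal (r / k * exp (c\<^sup>2 / r\<^sup>2)) * (\<integral>\<^sup>+ x. f (r * x) \<partial>std_gauss)"
    using q by (simp add: q_def[symmetric] ennreal_mult' mult.assoc)
  finally show ?thesis .
qed

text \<open>The one-dimensional factors multiply, so the centre \<open>c\<close> enters only through
  its energy. The integral on the right no longer depends on \<open>c\<close>: a single wide
  Gaussian dominates the output laws of all messages at once.\<close>

lemma gauss_domination:
  assumes "finite I" and k: "0 < k" and r: "0 < r" "2 * k\<^sup>2 \<le> r\<^sup>2"
    and "f \<in> borel_measurable (PiM I (\<lambda>_. borel))"
  shows "(\<integral>\<^sup>+ x. f (\<lambda>i\<in>I. c i + k * x i) \<partial>gauss I) \<le>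
    ennreal ((r / k) ^ card I * exp ((\<Sum>i\<in>I. (c i)\<^sup>2) / r\<^sup>2)) * (\<integral>\<^sup>+ x. f (\<lambda>i\<in>I. r * x i) \<partial>gauss I)"
  using assms(1,5)
proof (induction I arbitrary: f rule: finite_induct)
  case empty
  interpret product_sigma_finite "\<lambda>_. std_gauss" by (rule product_sigma_finite_std_gauss)
  show ?case by (simp add: PiM_empty nn_integral_count_space_finite restrict_def)
next
  case (insert i I)
  note [measurable] = insert.prems
  interpret product_sigma_finite "\<lambda>_. std_gauss" by (rule product_sigma_finite_std_gauss)
  interpret M: prob_space std_gauss by (rule prob_space_std_gauss)
  let ?K = "ennreal (r / k * exp ((c i)\<^sup>2 / r\<^sup>2))"
  let ?L = "ennreal ((r / k) ^ card I * exp ((\<Sum>i\<in>I. (c i)\<^sup>2) / r\<^sup>2))"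
  have upd: "(\<lambda>j\<in>insert i I. c j + k * (x(i := y)) j) = (\<lambda>j\<in>I. c j + k * x j)(i := c i + k * y)"
    "(\<lambda>j\<in>insert i I. r * (x(i := y)) j) = (\<lambda>j\<in>I. r * x j)(i := r * y)" for x y
    using insert.hyps by (auto simp: restrict_def fun_eq_iff)
  have m: "(\<lambda>x. \<integral>\<^sup>+ y. f (x(i := r * y)) \<partial>std_gauss) \<in> borel_measurable (PiM I (\<lambda>_. borel))"
    by measurable
  have "(\<integral>\<^sup>+ x. f (\<lambda>j\<in>insert i I. c j + k * x j) \<partial>gauss (insert i I)) =
      (\<integral>\<^sup>+ x. \<integral>\<^sup>+ y. f ((\<lambda>j\<in>I. c j + k * x j)(i := c i + k * y)) \<partial>std_gauss \<partial>gauss I)"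
    unfolding upd[symmetric] using insert.hyps
    by (subst product_nn_integral_insert, simp, simp, measurable)
  also have "\<dots> \<le> (\<integral>\<^sup>+ x. ?K * (\<integral>\<^sup>+ y. f ((\<lambda>j\<in>I. c j + k * x j)(i := r * y)) \<partial>std_gauss) \<partial>gauss I)"
    by (intro nn_integral_mono gauss_domination_1[OF k r]) measurable
  also have "\<dots> = ?K * (\<integral>\<^sup>+ x. \<integral>\<^sup>+ y. f ((\<lambda>j\<in>I. c j + k * x j)(i := r * y)) \<partial>std_gauss \<partial>gauss I)"
    by (intro nn_integral_cmult) measurable
  also have "\<dots> \<le> ?K * (?L * (\<integral>\<^sup>+ x. \<integral>\<^sup>+ y. f ((\<lambda>j\<in>I. r * x j)(i := r * y)) \<partial>std_gauss \<partial>gauss I))"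
    by (intro mult_left_mono insert.IH m) simp
  also have "\<dots> = (?K * ?L) * (\<integral>\<^sup>+ x. f (\<lambda>j\<in>insert i I. r * x j) \<partial>gauss (insert i I))"
    unfolding upd[symmetric] using insert.hyps
    by (subst product_nn_integral_insert, simp, simp, measurable) (simp add: mult.assoc)
  also have "?K * ?L = ennreal ((r / k) ^ card (insert i I) * exp ((\<Sum>i\<in>insert i I. (c i)\<^sup>2) / r\<^sup>2))"
    using insert.hyps k r by (simp flip: ennreal_mult' add: exp_add add_divide_distrib ac_simps)
  finally show ?case .
qed

section \<open>The converse bound\<close>

definition noiseless :: "real^2^2 \<Rightarrow> encoders \<Rightarrow> (2 \<Rightarrow> 2 \<Rightarrow> nat) \<Rightarrow> 2 \<Rightarrow> nat \<Rightarrow> real" where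
  "noiseless h enc W i t = (\<Sum>j\<in>UNIV. h $ i $ j * enc j (W 1 j, W 2 j) t)"

text \<open>Only the noise of receiver \<open>i\<close> enters, for a fixed message tuple. The joint
  law of the two noises has disappeared, which leaves the converse free to couple them.\<close>

definition rx_error ::
    "real^2^2 \<Rightarrow> nat \<Rightarrow> encoders \<Rightarrow> decoders \<Rightarrow> 2 \<Rightarrow> (2 \<Rightarrow> 2 \<Rightarrow> nat) \<Rightarrow> real" where
  "rx_error h N enc dec i W = measure (gauss {..<N})
     {z \<in> space (gauss {..<N}). dec i (\<lambda>t\<in>{..<N}. noiseless h enc W i t + z t) \<noteq> (W i 1, W i 2)}"

lemma distr_noise_gauss:
  "distr (noise N) (gauss {..<N}) (\<lambda>z. \<lambda>t\<in>{..<N}. z (i, t)) = gauss {..<N}"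
  unfolding noise_def
  by (rule distr_PiM_reindex) (auto intro: prob_space_std_gauss inj_onI)

lemma measurable_dec_shift:
  assumes "d \<in> PiM {..<N} (\<lambda>_. borel) \<rightarrow>\<^sub>M count_space UNIV"
  shows "{z \<in> space (gauss {..<N}). d (\<lambda>t\<in>{..<N}. c t + z t) \<noteq> (w :: nat \<times> nat)} \<in> sets (gauss {..<N})"
proof -
  note [measurable] = assms
  show ?thesis by measurable
qed

lemma rx_error_eq_noise:
  assumes dec: "dec i \<in> PiM {..<N} (\<lambda>_. borel) \<rightarrow>\<^sub>M count_space UNIV"
  shows "rx_error h N enc dec i W =
    measure (noise N) {z \<in> space (noise N). dec i (received h N enc W z i) \<noteq> (W i 1, W i 2)}"
proof -
  have m: "(\<lambda>z. \<lambda>t\<in>{..<N}. z (i, t)) \<in> noise N \<rightarrow>\<^sub>M gauss {..<N}"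
    unfolding noise_def by measurable
  have "rx_error h N enc dec i W = measure (distr (noise N) (gauss {..<N}) (\<lambda>z. \<lambda>t\<in>{..<N}. z (i, t)))
     {z \<in> space (gauss {..<N}). dec i (\<lambda>t\<in>{..<N}. noiseless h enc W i t + z t) \<noteq> (W i 1, W i 2)}"
    unfolding rx_error_def distr_noise_gauss ..
  also have "\<dots> = measure (noise N) ((\<lambda>z. \<lambda>t\<in>{..<N}. z (i, t)) -`
     {z \<in> space (gauss {..<N}). dec i (\<lambda>t\<in>{..<N}. noiseless h enc W i t + z t) \<noteq> (W i 1, W i 2)} \<inter> space (noise N))"
    using measurable_dec_shift[OF dec] by (intro measure_distr m) auto
  also have "(\<lambda>z. \<lambda>t\<in>{..<N}. z (i, t)) -`
     {z \<in> space (gauss {..<N}). dec i (\<lambda>t\<in>{..<N}. noiseless h enc W i t + z t) \<noteq> (W i 1, W i 2)} \<inter> space (noise N) =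
     {z \<in> space (noise N). dec i (received h N enc W z i) \<noteq> (W i 1, W i 2)}"
    using measurable_space[OF m] by (auto simp: received_def noiseless_def cong: restrict_cong)
  finally show ?thesis .
qed

text \<open>Fubini on the product of the uniform message law and the noise.\<close>

lemma error_prob_eq_average:
  assumes "X_code N P R enc dec"
  shows "error_prob h N R enc dec = (\<Sum>W\<in>messages N R. measure (noise N)
     {z \<in> space (noise N). \<exists>i. dec i (received h N enc W z i) \<noteq> (W i 1, W i 2)}) / card (messages N R)"
proof -
  interpret noise: prob_space "noise N"
    unfolding noise_def by (rule prob_space_gauss)
  interpret all: prob_space "message_noise_space N R" by (rule prob_space_message_noise)
  let ?E = "\<lambda>W. {z \<in> space (noise N). \<exists>i. dec i (received h N enc W z i) \<noteq> (W i 1, W i 2)}"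
  have E: "Pair W -` error_event h N R enc dec = ?E W" for W
    by (auto simp: error_event_def message_noise_space_def space_pair_measure)
  have fin: "finite (messages N R)" "messages N R \<noteq> {}" by (rule messages_finite_nonempty)+
  have "ennreal (error_prob h N R enc dec) = emeasure (message_noise_space N R) (error_event h N R enc dec)"
    unfolding error_prob_def by (simp add: all.emeasure_eq_measure)
  also have "\<dots> = (\<integral>\<^sup>+ W. emeasure (noise N) (?E W) \<partial>measure_pmf (pmf_of_set (messages N R)))"
    using error_event_measurable[OF assms, of h] unfolding message_noise_space_def
    by (subst noise.emeasure_pair_measure_alt) (auto simp: E)
  also have "\<dots> = (\<Sum>W\<in>messages N R. ennreal (measure (noise N) (?E W))) / card (messages N R)"
    using fin by (simp add: nn_integral_pmf_of_set noise.emeasure_eq_measure)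
  also have "\<dots> = ennreal ((\<Sum>W\<in>messages N R. measure (noise N) (?E W)) / card (messages N R))"
    using fin by (simp add: sum_ennreal ennreal_of_nat_eq_real_of_nat divide_ennreal sum_nonneg card_gt_0_iff)
  finally show ?thesis
    by (subst (asm) ennreal_inj) (auto simp: error_prob_def sum_nonneg)
qed

text \<open>For the converse: an error at one receiver is an error of the code.\<close>

lemma sum_rx_error_le:
  assumes code: "X_code N P R enc dec"
  shows "(\<Sum>W\<in>messages N R. rx_error h N enc dec i W) \<le> card (messages N R) * error_prob h N R enc dec"
proof -
  interpret noise: prob_space "noise N"
    unfolding noise_def by (rule prob_space_gauss)
  have dec: "dec i \<in> PiM {..<N} (\<lambda>_. borel) \<rightarrow>\<^sub>M count_space UNIV" for i
    using code by (auto simp: X_code_def)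
  have [measurable]: "(\<lambda>z. dec i (received h N enc W z i)) \<in> noise N \<rightarrow>\<^sub>M count_space UNIV" for W i
    unfolding received_def noise_def by (rule measurable_compose[OF _ dec]) measurable
  have "(\<Sum>W\<in>messages N R. rx_error h N enc dec i W) \<le> (\<Sum>W\<in>messages N R. measure (noise N)
     {z \<in> space (noise N). \<exists>i. dec i (received h N enc W z i) \<noteq> (W i 1, W i 2)})"
    unfolding rx_error_eq_noise[where dec = dec, OF dec]
    by (intro sum_mono noise.finite_measure_mono) (auto, measurable)
  also have "\<dots> = card (messages N R) * error_prob h N R enc dec"
    using messages_finite_nonempty by (simp add: error_prob_eq_average[OF code])
  finally show ?thesis .
qed

text \<open>For achievability: a union bound over the two receivers, uniform in the messages and
  therefore valid for their average.\<close>

lemma error_prob_le: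
  assumes code: "X_code N P R enc dec"
    and le: "\<And>W i. W \<in> messages N R \<Longrightarrow> rx_error h N enc dec i W \<le> e"
  shows "error_prob h N R enc dec \<le> 2 * e"
proof -
  interpret noise: prob_space "noise N"
    unfolding noise_def by (rule prob_space_gauss)
  have dec: "dec i \<in> PiM {..<N} (\<lambda>_. borel) \<rightarrow>\<^sub>M count_space UNIV" for i
    using code by (auto simp: X_code_def)
  have [measurable]: "(\<lambda>z. dec i (received h N enc W z i)) \<in> noise N \<rightarrow>\<^sub>M count_space UNIV" for W i
    unfolding received_def noise_def by (rule measurable_compose[OF _ dec]) measurable
  let ?E = "\<lambda>W i. {z \<in> space (noise N). dec i (received h N enc W z i) \<noteq> (W i 1, W i 2)}"
  have "measure (noise N) {z \<in> space (noise N). \<exists>i. dec i (received h N enc W z i) \<noteq> (W i 1, W i 2)} \<le> 2 * e"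
    if W: "W \<in> messages N R" for W
  proof -
    have "{z \<in> space (noise N). \<exists>i. dec i (received h N enc W z i) \<noteq> (W i 1, W i 2)} = (\<Union>i. ?E W i)" by auto
    also have "measure (noise N) \<dots> \<le> (\<Sum>i\<in>UNIV. measure (noise N) (?E W i))"
      by (intro noise.finite_measure_subadditive_finite) auto
    also have "\<dots> \<le> (\<Sum>i\<in>(UNIV::2 set). e)"
      using le[OF W] unfolding rx_error_eq_noise[where dec = dec, OF dec] by (intro sum_mono)
    finally show ?thesis by simp
  qed
  then have "(\<Sum>W\<in>messages N R. measure (noise N) {z \<in> space (noise N). \<exists>i. dec i (received h N enc W z i) \<noteq> (W i 1, W i 2)})
      \<le> card (messages N R) * (2 * e)" by (intro sum_bounded_above)
  moreover have "card (messages N R) > 0" using messages_finite_nonempty by (simp add: card_gt_0_iff)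
  ultimately show ?thesis
    unfolding error_prob_eq_average[OF code] by (simp add: divide_le_eq ac_simps)
qed

section \<open>Point-to-point bound for three messages\<close>

lemma eq_fun_2:
  assumes "i \<noteq> (i' :: 2)" "f i = g i" "f i' = g i'" shows "f = g"
proof
  fix k show "f k = g k" using exhaust_2[of i] exhaust_2[of i'] exhaust_2[of k] assms by auto
qed

text \<open>One message is fixed; the other three are decoded from a single noisy observation \<open>y\<close> of
  transmitter \<open>j\<close>, so they are limited by a point-to-point bound. The two physical noises are
  coupled as \<open>\<kappa> * h $ l $ j * z0 + \<dots>\<close> with a common \<open>z0\<close>; only their marginals matter.\<close>

lemma three_message_bound:
  fixes h :: "real^2^2"
  assumes code: "X_code N P R enc dec" and h: "\<And>i j. 0 < h $ i $ j"
    and ne: "i \<noteq> i'" "j \<noteq> j'"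
    and \<kappa>: "\<kappa> = 1 / (h $ i $ j + h $ i' $ j)" and g: "g = h $ i $ j' / h $ i $ j"
    and r: "0 < r" "r\<^sup>2 = 2 * (1 + g\<^sup>2) * P" "2 * \<kappa>\<^sup>2 \<le> r\<^sup>2"
  shows "card (messages N R) * (1 - 2 * error_prob h N R enc dec) \<le>
    num_messages N (R i' j') * (exp 1 * r / \<kappa>) ^ N"
proof -
  let ?I = "{..<N}" and ?G = "gauss {..<N}" and ?M = "messages N R"
  interpret G: prob_space ?G by (rule prob_space_gauss)
  have dec[measurable]: "dec l \<in> PiM {..<N} (\<lambda>_. borel) \<rightarrow>\<^sub>M count_space UNIV" for l
    using code by (auto simp: X_code_def)
  define X where "X l W = enc l (W 1 l, W 2 l)" for l and W :: "2 \<Rightarrow> 2 \<Rightarrow> nat"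
  have UNIVj: "(UNIV :: 2 set) = {j, j'}" using ne(2) exhaust_2[of j] exhaust_2[of j'] by (auto simp: UNIV_2)
  have s: "noiseless h enc W l t = h $ l $ j * X j W t + h $ l $ j' * X j' W t" for W l t
    unfolding noiseless_def UNIVj X_def using ne(2) by simp
  have k0: "0 < \<kappa>" using h \<kappa> by (simp add: add_pos_pos)
  \<comment> \<open>Receiver \<open>l\<close> gets the noise \<open>b l * n + a l * n0\<close>,
    where \<open>n0\<close> is common and \<open>n\<close> is private. The choice of
    \<open>\<kappa>\<close> makes \<open>a l < 1\<close>, and \<open>b l\<close> restores unit
    variance.\<close>
  define a where "a l = \<kappa> * h $ l $ j" for l
  define b where "b l = sqrt (1 - (a l)\<^sup>2)" for l
  have a01: "0 < a l \<and> a l < 1" for l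
  proof -
    have "l = i \<or> l = i'" using ne(1) exhaust_2[of l] exhaust_2[of i] exhaust_2[of i'] by auto
    then show ?thesis using h[of i j] h[of i' j] by (auto simp: a_def \<kappa>)
  qed
  have a: "0 < a l" "0 < b l" "(b l)\<^sup>2 + (a l)\<^sup>2 = 1" for l
    using a01[of l] by (auto simp: b_def power2_less_1_iff power_le_one abs_square_less_1)
  define F where "F l n1 W n0 = (if dec l (\<lambda>t\<in>?I. noiseless h enc W l t + (b l * n1 t + a l * n0 t)) = (W l 1, W l 2)
      then 0 else 1 :: ennreal)" for l n1 W n0
  define c where "c W t = X j W t + g * X j' W t" for W t
  \<comment> \<open>The rebuilt outputs: \<open>h $ i $ j * y\<close> imitates receiver
    \<open>i\<close>; replacing the contribution of transmitter \<open>j'\<close> by its correct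
    multiple imitates receiver \<open>i'\<close>. \<open>K\<close> says that both decoders then
    return \<open>W\<close>.\<close>
  define K where "K n1 n2 W y \<longleftrightarrow> dec i (\<lambda>t\<in>?I. h $ i $ j * y t + b i * n1 t) = (W i 1, W i 2) \<and>
      dec i' (\<lambda>t\<in>?I. h $ i' $ j * (y t - g * X j' W t) + h $ i' $ j' * X j' W t + b i' * n2 t) = (W i' 1, W i' 2)"
    for n1 n2 W y
  define H where "H n1 n2 W y = (if K n1 n2 W y then 1 else 0 :: ennreal)" for n1 n2 W y
  define L where "L = ennreal ((exp 1 * r / \<kappa>) ^ N)"
  \<comment> \<open>By rotation invariance the split noise has the law of the physical
    noise.\<close>
  have errF: "(\<integral>\<^sup>+ n1. \<integral>\<^sup>+ n0. F l n1 W n0 \<partial>?G \<partial>?G) = ennreal (rx_error h N enc dec l W)" for l W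
  proof -
    let ?A = "{z \<in> space ?G. dec l (\<lambda>t\<in>?I. noiseless h enc W l t + z t) \<noteq> (W l 1, W l 2)}"
    define f where "f z = (if dec l (\<lambda>t\<in>?I. noiseless h enc W l t + z t) = (W l 1, W l 2) then 0 else 1 :: ennreal)" for z
    have [measurable]: "f \<in> borel_measurable (PiM ?I (\<lambda>_. borel))" unfolding f_def by measurable
    have "(\<integral>\<^sup>+ n1. \<integral>\<^sup>+ n0. F l n1 W n0 \<partial>?G \<partial>?G) =
        (\<integral>\<^sup>+ n1. \<integral>\<^sup>+ n0. f (\<lambda>t\<in>?I. b l * n1 t + a l * n0 t) \<partial>?G \<partial>?G)"
      unfolding F_def f_def by (intro nn_integral_cong) (simp cong: restrict_cong)
    also have "\<dots> = (\<integral>\<^sup>+ z. f z \<partial>?G)" by (intro gauss_rotation a) auto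
    also have "\<dots> = (\<integral>\<^sup>+ z. indicator ?A z \<partial>?G)"
      by (intro nn_integral_cong) (auto simp: f_def indicator_def)
    also have "\<dots> = ennreal (rx_error h N enc dec l W)"
      unfolding rx_error_def by (simp add: measurable_dec_shift[OF dec] G.emeasure_eq_measure)
    finally show ?thesis .
  qed
  have Fm[measurable]: "(\<lambda>(n1, n0). F l n1 W n0) \<in> borel_measurable (?G \<Otimes>\<^sub>M ?G)" for l W
    unfolding F_def by measurable
  \<comment> \<open>For a fixed observation, a consistent \<open>W\<close> is determined by
    \<open>W i' j'\<close>: the first decoder yields \<open>W i\<close>, this and
    \<open>W i' j'\<close> fix the signal of transmitter \<open>j'\<close>, and then the second
    decoder yields \<open>W i'\<close>.\<close>
  have card_le: "(\<Sum>W\<in>?M. H n1 n2 W y) \<le> of_nat (num_messages N (R i' j'))" for n1 n2 y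
  proof -
    let ?D = "{W \<in> ?M. K n1 n2 W y}"
    have D1: "dec i (\<lambda>t\<in>?I. h $ i $ j * y t + b i * n1 t) = (W i 1, W i 2)"
      and D2: "dec i' (\<lambda>t\<in>?I. h $ i' $ j * (y t - g * X j' W t) + h $ i' $ j' * X j' W t + b i' * n2 t) = (W i' 1, W i' 2)"
      if "W \<in> ?D" for W
      using that by (simp_all add: K_def)
    have "inj_on (\<lambda>W. W i' j') ?D"
    proof (rule inj_onI)
      fix W W' assume W: "W \<in> ?D" "W' \<in> ?D" and eq: "W i' j' = W' i' j'"
      have "(W i 1, W i 2) = (W' i 1, W' i 2)"
        using D1[OF W(1)] D1[OF W(2)] by (rule trans[OF sym])
      then have 1: "W i = W' i" by (intro eq_fun_2[of 1 2]) auto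
      have "(\<lambda>l. W l j') = (\<lambda>l. W' l j')" using ne(1) eq 1 by (intro eq_fun_2[of i i']) auto
      then have "X j' W = X j' W'" unfolding X_def by metis
      then have "(W i' 1, W i' 2) = (W' i' 1, W' i' 2)"
        using D2[OF W(1)] D2[OF W(2)] by (metis (no_types))
      then have "W i' = W' i'" by (intro eq_fun_2[of 1 2]) auto
      with 1 show "W = W'" using ne(1) by (intro eq_fun_2[of i i']) auto
    qed
    then have "card ?D \<le> card {..<num_messages N (R i' j')}"
      by (rule card_inj_on_le) (auto simp: messages_def)
    have "(\<Sum>W\<in>?M. H n1 n2 W y) = (\<Sum>W\<in>?D. H n1 n2 W y)"
      by (intro sum.mono_neutral_right messages_finite_nonempty) (auto simp: H_def)
    also have "\<dots> = (\<Sum>W\<in>?D. 1)" by (intro sum.cong) (auto simp: H_def)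
    also have "\<dots> = of_nat (card ?D)" by simp
    also have "\<dots> \<le> of_nat (num_messages N (R i' j'))" using \<open>card ?D \<le> _\<close> by simp
    finally show ?thesis .
  qed
  \<comment> \<open>The power constraint and the choice of \<open>r\<close> keep the exponential
    factor of the domination below \<open>exp N\<close>.\<close>
  have c_bound: "(\<Sum>t<N. (c W t)\<^sup>2) / r\<^sup>2 \<le> N" if "W \<in> ?M" for W
  proof -
    have pw: "(\<Sum>t<N. (X l W t)\<^sup>2) \<le> N * P" for l using code that by (auto simp: X_code_def X_def)
    have "(c W t)\<^sup>2 \<le> 2 * (X j W t)\<^sup>2 + 2 * g\<^sup>2 * (X j' W t)\<^sup>2" for t
      using sum_squares_bound[of "X j W t" "g * X j' W t"]
      by (simp add: c_def power2_sum power_mult_distrib)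
    then have "(\<Sum>t<N. (c W t)\<^sup>2) \<le> (\<Sum>t<N. 2 * (X j W t)\<^sup>2 + 2 * g\<^sup>2 * (X j' W t)\<^sup>2)" by (rule sum_mono)
    also have "\<dots> = 2 * (\<Sum>t<N. (X j W t)\<^sup>2) + 2 * g\<^sup>2 * (\<Sum>t<N. (X j' W t)\<^sup>2)"
      by (simp add: sum.distrib sum_distrib_left)
    also have "\<dots> \<le> 2 * (N * P) + 2 * g\<^sup>2 * (N * P)"
      by (intro add_mono mult_left_mono pw) auto
    also have "\<dots> = N * r\<^sup>2" unfolding r(2) by (simp add: algebra_simps)
    finally show ?thesis using r(1) by (simp add: divide_le_eq)
  qed
  \<comment> \<open>Domination replaces the laws of \<open>y\<close>, which depend on
    \<open>W\<close>, by a common one; the sum over \<open>W\<close> can then go under the integral,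
    where \<open>card_le\<close> applies.\<close>
  have S_bound: "(\<Sum>W\<in>?M. \<integral>\<^sup>+ n0. H n1 n2 W (\<lambda>t\<in>?I. c W t + \<kappa> * n0 t) \<partial>?G) \<le>
      of_nat (num_messages N (R i' j')) * L" for n1 n2
  proof -
    have [measurable]: "H n1 n2 W \<in> borel_measurable (PiM ?I (\<lambda>_. borel))" for W
      unfolding H_def K_def by measurable
    have "(\<integral>\<^sup>+ n0. H n1 n2 W (\<lambda>t\<in>?I. c W t + \<kappa> * n0 t) \<partial>?G) \<le> L * (\<integral>\<^sup>+ y. H n1 n2 W (\<lambda>t\<in>?I. r * y t) \<partial>?G)"
      if W: "W \<in> ?M" for W
    proof -
      have "(\<integral>\<^sup>+ n0. H n1 n2 W (\<lambda>t\<in>?I. c W t + \<kappa> * n0 t) \<partial>?G) \<le>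
        ennreal ((r / \<kappa>) ^ card ?I * exp ((\<Sum>t<N. (c W t)\<^sup>2) / r\<^sup>2)) * (\<integral>\<^sup>+ y. H n1 n2 W (\<lambda>t\<in>?I. r * y t) \<partial>?G)"
        by (intro gauss_domination k0 r) auto
      also have "\<dots> \<le> L * (\<integral>\<^sup>+ y. H n1 n2 W (\<lambda>t\<in>?I. r * y t) \<partial>?G)"
      proof (intro mult_right_mono)
        have "(r / \<kappa>) ^ card ?I * exp ((\<Sum>t<N. (c W t)\<^sup>2) / r\<^sup>2) \<le> (r / \<kappa>) ^ N * exp (real N * 1)"
          using c_bound[OF W] k0 r(1) by (intro mult_mono) auto
        also have "\<dots> = (exp 1 * r / \<kappa>) ^ N"
          unfolding exp_of_nat_mult by (simp flip: power_mult_distrib add: mult.commute)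
        finally show "ennreal ((r / \<kappa>) ^ card ?I * exp ((\<Sum>t<N. (c W t)\<^sup>2) / r\<^sup>2)) \<le> L"
          unfolding L_def by (rule ennreal_leI)
      qed simp
      finally show ?thesis .
    qed
    then have "(\<Sum>W\<in>?M. \<integral>\<^sup>+ n0. H n1 n2 W (\<lambda>t\<in>?I. c W t + \<kappa> * n0 t) \<partial>?G) \<le>
        (\<Sum>W\<in>?M. L * (\<integral>\<^sup>+ y. H n1 n2 W (\<lambda>t\<in>?I. r * y t) \<partial>?G))" by (rule sum_mono)
    also have "\<dots> = L * (\<integral>\<^sup>+ y. (\<Sum>W\<in>?M. H n1 n2 W (\<lambda>t\<in>?I. r * y t)) \<partial>?G)"
      by (subst nn_integral_sum) (auto simp: sum_distrib_left)
    also have "\<dots> \<le> L * (\<integral>\<^sup>+ y. of_nat (num_messages N (R i' j')) \<partial>?G)"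
      by (intro mult_left_mono nn_integral_mono card_le) auto
    also have "\<dots> = of_nat (num_messages N (R i' j')) * L"
      by (simp add: G.emeasure_space_1 mult.commute)
    finally show ?thesis .
  qed
  \<comment> \<open>Either both decoders are right or one of the error indicators \<open>F\<close>
    equals 1.\<close>
  have split: "1 \<le> H n1 n2 W (\<lambda>t\<in>?I. c W t + \<kappa> * n0 t) + F i n1 W n0 + F i' n2 W n0" for n0 n1 n2 W
  proof -
    have 1: "(\<lambda>t\<in>?I. h $ i $ j * (\<lambda>t\<in>?I. c W t + \<kappa> * n0 t) t + b i * n1 t) =
        (\<lambda>t\<in>?I. noiseless h enc W i t + (b i * n1 t + a i * n0 t))"
      using h[of i j] by (intro restrict_ext) (simp add: s c_def g a_def field_simps)
    have 2: "(\<lambda>t\<in>?I. h $ i' $ j * ((\<lambda>t\<in>?I. c W t + \<kappa> * n0 t) t - g * X j' W t) + h $ i' $ j' * X j' W t + b i' * n2 t) =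
        (\<lambda>t\<in>?I. noiseless h enc W i' t + (b i' * n2 t + a i' * n0 t))"
      by (intro restrict_ext) (simp add: s c_def a_def algebra_simps)
    show ?thesis unfolding H_def K_def 1 2 F_def by simp
  qed
  have ptw: "of_nat (card ?M) \<le> of_nat (num_messages N (R i' j')) * L +
      (\<Sum>W\<in>?M. \<integral>\<^sup>+ n0. F i n1 W n0 \<partial>?G) + (\<Sum>W\<in>?M. \<integral>\<^sup>+ n0. F i' n2 W n0 \<partial>?G)"
    if n: "n1 \<in> space ?G" "n2 \<in> space ?G" for n1 n2
  proof -
    have [measurable]: "H n1 n2 W \<in> borel_measurable (PiM ?I (\<lambda>_. borel))" for W
      unfolding H_def K_def by measurable
    have [measurable]: "F l n W \<in> borel_measurable ?G" for l n W
      unfolding F_def by measurable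
    have "of_nat (card ?M) = (\<Sum>W\<in>?M. \<integral>\<^sup>+ n0. 1 \<partial>?G)" by (simp add: G.emeasure_space_1)
    also have "\<dots> \<le> (\<Sum>W\<in>?M. \<integral>\<^sup>+ n0. H n1 n2 W (\<lambda>t\<in>?I. c W t + \<kappa> * n0 t) + F i n1 W n0 + F i' n2 W n0 \<partial>?G)"
      by (intro sum_mono nn_integral_mono split)
    also have "\<dots> = (\<Sum>W\<in>?M. \<integral>\<^sup>+ n0. H n1 n2 W (\<lambda>t\<in>?I. c W t + \<kappa> * n0 t) \<partial>?G) +
      (\<Sum>W\<in>?M. \<integral>\<^sup>+ n0. F i n1 W n0 \<partial>?G) + (\<Sum>W\<in>?M. \<integral>\<^sup>+ n0. F i' n2 W n0 \<partial>?G)"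
      by (simp add: nn_integral_add sum.distrib)
    finally show ?thesis using S_bound[of n1 n2] by (meson add_right_mono order_trans)
  qed
  define m where "m = num_messages N (R i' j')"
  have "of_nat (card ?M) = (\<integral>\<^sup>+ n1. \<integral>\<^sup>+ n2. of_nat (card ?M) \<partial>?G \<partial>?G)" by (simp add: G.emeasure_space_1)
  \<comment> \<open>Integrating over the private noises as well turns each \<open>F\<close> term
    into an \<open>rx_error\<close>; no joint error probability is needed, since the two error terms
    are added.\<close>
  also have "\<dots> \<le> (\<integral>\<^sup>+ n1. \<integral>\<^sup>+ n2. of_nat m * L +
      (\<Sum>W\<in>?M. \<integral>\<^sup>+ n0. F i n1 W n0 \<partial>?G) + (\<Sum>W\<in>?M. \<integral>\<^sup>+ n0. F i' n2 W n0 \<partial>?G) \<partial>?G \<partial>?G)"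
    unfolding m_def by (intro nn_integral_mono ptw)
  also have "\<dots> = of_nat m * L + (\<Sum>W\<in>?M. \<integral>\<^sup>+ n1. \<integral>\<^sup>+ n0. F i n1 W n0 \<partial>?G \<partial>?G) +
      (\<Sum>W\<in>?M. \<integral>\<^sup>+ n2. \<integral>\<^sup>+ n0. F i' n2 W n0 \<partial>?G \<partial>?G)"
    by (simp add: nn_integral_add nn_integral_sum G.emeasure_space_1)
  also have "\<dots> = of_nat m * L + ennreal (\<Sum>W\<in>?M. rx_error h N enc dec i W) +
      ennreal (\<Sum>W\<in>?M. rx_error h N enc dec i' W)"
    unfolding errF by (simp add: sum_ennreal rx_error_def)
  also have "\<dots> \<le> of_nat m * L + ennreal (card ?M * error_prob h N R enc dec) +
      ennreal (card ?M * error_prob h N R enc dec)"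
    by (intro add_mono ennreal_leI sum_rx_error_le[OF code]) auto
  also have "\<dots> = ennreal (m * (exp 1 * r / \<kappa>) ^ N + 2 * (card ?M * error_prob h N R enc dec))"
    using k0 r(1) by (simp add: L_def ennreal_of_nat_eq_real_of_nat error_prob_def flip: ennreal_mult' ennreal_plus)
  finally have "real (card ?M) \<le> m * (exp 1 * r / \<kappa>) ^ N + 2 * (card ?M * error_prob h N R enc dec)"
    using k0 r(1) by (subst (asm) ennreal_of_nat_eq_real_of_nat, subst (asm) ennreal_le_iff)
      (auto intro!: add_nonneg_nonneg mult_nonneg_nonneg simp: error_prob_def)
  then show ?thesis by (simp add: m_def algebra_simps)
qed


section \<open>Rate bounds and the upper bound on the degrees of freedom\<close>

lemma card_messages:
  "card (messages N R) = (\<Prod>i\<in>UNIV. \<Prod>j\<in>UNIV. num_messages N (R i j))"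
proof -
  have "messages N R = (\<Pi>\<^sub>E i\<in>UNIV. \<Pi>\<^sub>E j\<in>UNIV. {..<num_messages N (R i j)})"
    by (auto simp: messages_def PiE_UNIV_domain Pi_def)
  then show ?thesis by (simp add: card_PiE)
qed

lemma num_messages_ge: "2 powr (real N * r) \<le> real (num_messages N r)"
  unfolding num_messages_def by linarith

lemma num_messages_pos: "0 < num_messages N r"
  unfolding num_messages_def by (simp add: ceiling_less_zero)

text \<open>The number of choices for \<open>W i' j'\<close> is a factor on both sides of
  \<open>three_message_bound\<close> and cancels. Taking \<open>N\<close>-th roots then removes the
  constant caused by errors.\<close>

lemma three_rate_bound:
  fixes h :: "real^2^2"
  assumes ach: "achievable h P R" and h: "\<And>i j. 0 < h $ i $ j"
    and ne: "i \<noteq> i'" "j \<noteq> j'"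
    and \<kappa>: "\<kappa> = 1 / (h $ i $ j + h $ i' $ j)" and g: "g = h $ i $ j' / h $ i $ j"
    and r: "0 < r" "r\<^sup>2 = 2 * (1 + g\<^sup>2) * P" "2 * \<kappa>\<^sup>2 \<le> r\<^sup>2"
  shows "R i j + R i j' + R i' j \<le> log 2 (exp 1 * r / \<kappa>)"
proof -
  define S where "S = R i j + R i j' + R i' j"
  define B where "B = exp 1 * r / \<kappa>"
  have "0 < \<kappa>" using h \<kappa> by (simp add: add_pos_pos)
  then have B: "0 < B" using r by (simp add: B_def)
  obtain N enc dec where N: "filterlim N at_top sequentially"
    and code: "\<And>k::nat. X_code (N k) P R (enc k) (dec k)"
    and err: "(\<lambda>k. error_prob h (N k) R (enc k) (dec k)) \<longlonglongrightarrow> 0"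
    using ach by (auto simp: achievable_def)
  \<comment> \<open>Error below \<open>1 / 4\<close> keeps the factor
    \<open>1 - 2 * error_prob\<close> above \<open>1 / 2\<close>, which costs one bit per block,
    that is \<open>1 / N\<close> in rate.\<close>
  have 1: "S \<le> log 2 B + 1 / real (N k)"
    if e: "error_prob h (N k) R (enc k) (dec k) < 1 / 4" and Nk: "1 \<le> N k" for k
  proof -
    define m where "m l l' = real (num_messages (N k) (R l l'))" for l l'
    have UNIVi: "(UNIV :: 2 set) = {i, i'}"
      using ne(1) exhaust_2[of i] exhaust_2[of i'] by (auto simp: UNIV_2)
    have UNIVj: "(UNIV :: 2 set) = {j, j'}"
      using ne(2) exhaust_2[of j] exhaust_2[of j'] by (auto simp: UNIV_2)
    have inner: "(\<Prod>l\<in>UNIV. num_messages (N k) (R a l)) = num_messages (N k) (R a j) * num_messages (N k) (R a j')" for a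
      unfolding UNIVj using ne(2) by simp
    have card: "real (card (messages (N k) R)) = m i' j' * (m i j * m i j' * m i' j)"
      unfolding card_messages inner unfolding UNIVi using ne(1) by (simp add: m_def)
    have mpos: "0 < m l l'" for l l' by (simp add: m_def num_messages_pos)
    have "m i' j' * (m i j * m i j' * m i' j * (1 - 2 * error_prob h (N k) R (enc k) (dec k))) \<le> m i' j' * B ^ N k"
      using three_message_bound[OF code[of k] h ne \<kappa> g r] unfolding card by (simp add: B_def m_def mult.assoc)
    then have "m i j * m i j' * m i' j * (1 - 2 * error_prob h (N k) R (enc k) (dec k)) \<le> B ^ N k"
      using mpos by simp
    moreover have "2 powr (N k * S) \<le> m i j * m i j' * m i' j"
    proof -
      have "2 powr (N k * S) = 2 powr (N k * R i j) * 2 powr (N k * R i j') * 2 powr (N k * R i' j)"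
        by (simp add: S_def distrib_left powr_add)
      also have "\<dots> \<le> m i j * m i j' * m i' j"
        unfolding m_def by (intro mult_mono num_messages_ge) auto
      finally show ?thesis .
    qed
    then have "2 powr (N k * S) * (1 / 2) \<le> m i j * m i j' * m i' j * (1 - 2 * error_prob h (N k) R (enc k) (dec k))"
      using e mpos by (intro mult_mono) (auto intro!: less_imp_le)
    ultimately have "2 powr (N k * S) * (1 / 2) \<le> B ^ N k" by linarith
    then have "log 2 (2 powr (N k * S) * (1 / 2)) \<le> log 2 (B ^ N k)"
      by (intro log_mono) auto
    then have "N k * S - 1 \<le> N k * log 2 B"
      using B by (simp add: log_mult log_divide log_nat_power)
    then show ?thesis using Nk by (simp add: field_simps)
  qed
  have "((\<lambda>k. log 2 B + 1 / real (N k)) \<longlongrightarrow> log 2 B + 0) sequentially"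
    by (intro tendsto_add tendsto_const filterlim_compose[OF lim_1_over_n N])
  moreover have "eventually (\<lambda>k. S \<le> log 2 B + 1 / real (N k)) sequentially"
  proof -
    have "eventually (\<lambda>k. error_prob h (N k) R (enc k) (dec k) < 1 / 4) sequentially"
      using order_tendstoD(2)[OF err, of "1 / 4"] by simp
    moreover have "eventually (\<lambda>k. 1 \<le> N k) sequentially"
      using N by (simp add: filterlim_at_top)
    ultimately show ?thesis by eventually_elim (rule 1)
  qed
  ultimately have "S \<le> log 2 B + 0"
    by (intro tendsto_lowerbound) auto
  then show ?thesis by (simp add: S_def B_def)
qed

text \<open>The radius \<open>r\<close> is a constant times \<open>sqrt P\<close>, and
  \<open>P \<ge> \<kappa>^2\<close> secures the domination condition.\<close>

lemma three_rate_bound_log: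
  fixes h :: "real^2^2"
  assumes h: "\<And>i j. 0 < h $ i $ j" and ne: "i \<noteq> i'" "j \<noteq> j'"
  shows "\<exists>C. \<forall>\<^sub>F P in at_top. \<forall>R. achievable h P R \<longrightarrow> R i j + R i j' + R i' j \<le> 1 / 2 * log 2 P + C"
proof -
  define \<kappa> where "\<kappa> = 1 / (h $ i $ j + h $ i' $ j)"
  define g where "g = h $ i $ j' / h $ i $ j"
  define q where "q = sqrt (2 * (1 + g\<^sup>2))"
  have "0 < \<kappa>" using h by (simp add: \<kappa>_def add_pos_pos)
  have q: "0 < q" "q\<^sup>2 = 2 * (1 + g\<^sup>2)"
    by (simp_all add: q_def add_pos_nonneg)
  have q2: "2 \<le> q\<^sup>2" using q(2) by simp
  have "R i j + R i j' + R i' j \<le> 1 / 2 * log 2 P + log 2 (exp 1 * q / \<kappa>)"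
    if P: "max 1 (\<kappa>\<^sup>2) \<le> P" and ach: "achievable h P R" for P R
  proof -
    define r where "r = q * sqrt P"
    have r: "0 < r" "r\<^sup>2 = 2 * (1 + g\<^sup>2) * P" "2 * \<kappa>\<^sup>2 \<le> r\<^sup>2"
      using q P mult_mono[of 2 "q\<^sup>2" "\<kappa>\<^sup>2" P] q2 by (auto simp: r_def power_mult_distrib)
    have "exp 1 * r / \<kappa> = (exp 1 * q / \<kappa>) * sqrt P" by (simp add: r_def)
    also have "log 2 \<dots> = log 2 (exp 1 * q / \<kappa>) + log 2 (sqrt P)"
      using q \<open>0 < \<kappa>\<close> P by (subst log_mult) auto
    also have "log 2 (sqrt P) = 1 / 2 * log 2 P"
      using P by (simp add: log_def ln_sqrt)
    finally show ?thesis
      using three_rate_bound[OF ach h ne \<kappa>_def g_def r] by simp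
  qed
  then show ?thesis unfolding eventually_at_top_linorder by blast
qed

lemma total_dof_le:
  fixes h :: "real^2^2"
  assumes h: "\<And>i j. 0 < h $ i $ j"
  shows "total_dof h \<le> ereal (4 / 3)"
proof -
  have ne: "(1::2) \<noteq> 2" by simp
  obtain C1 where C1: "\<forall>\<^sub>F P in at_top. \<forall>R. achievable h P R \<longrightarrow> R 1 1 + R 1 2 + R 2 1 \<le> 1 / 2 * log 2 P + C1"
    using three_rate_bound_log[OF h ne ne] by blast
  obtain C2 where C2: "\<forall>\<^sub>F P in at_top. \<forall>R. achievable h P R \<longrightarrow> R 1 2 + R 1 1 + R 2 2 \<le> 1 / 2 * log 2 P + C2"
    using three_rate_bound_log[OF h ne ne[symmetric]] by blast
  obtain C3 where C3: "\<forall>\<^sub>F P in at_top. \<forall>R. achievable h P R \<longrightarrow> R 2 1 + R 2 2 + R 1 1 \<le> 1 / 2 * log 2 P + C3"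
    using three_rate_bound_log[OF h ne[symmetric] ne] by blast
  obtain C4 where C4: "\<forall>\<^sub>F P in at_top. \<forall>R. achievable h P R \<longrightarrow> R 2 2 + R 2 1 + R 1 2 \<le> 1 / 2 * log 2 P + C4"
    using three_rate_bound_log[OF h ne[symmetric] ne[symmetric]] by blast
  \<comment> \<open>Each of the four rates occurs in exactly three of the four bounds, hence the
    division by 3.\<close>
  define C where "C = (C1 + C2 + C3 + C4) / 3"
  have "\<forall>\<^sub>F P in at_top. sum_capacity h P / ereal (1 / 2 * log 2 P) \<le>
      ereal ((4 / 3 * (1 / 2 * log 2 P) + C) / (1 / 2 * log 2 P))"
    using C1 C2 C3 C4 eventually_gt_at_top[of 1]
  proof eventually_elim
    case (elim P)
    have "(\<Sum>i\<in>UNIV. \<Sum>j\<in>UNIV. R i j) \<le> 4 / 3 * (1 / 2 * log 2 P) + C" if "achievable h P R" for R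
      using elim(1-4)[rule_format, OF that] by (simp add: UNIV_2 C_def add_divide_distrib)
    then have "sum_capacity h P \<le> ereal (4 / 3 * (1 / 2 * log 2 P) + C)"
      unfolding sum_capacity_def by (intro SUP_least) auto
    then have "sum_capacity h P / ereal (1 / 2 * log 2 P) \<le> ereal (4 / 3 * (1 / 2 * log 2 P) + C) / ereal (1 / 2 * log 2 P)"
      using elim(5) by (intro ereal_divide_right_mono) auto
    moreover have "0 < log 2 P" using elim(5) by (subst zero_less_log_cancel_iff) auto
    then have "1 / 2 * log 2 P \<noteq> 0" by simp
    ultimately show ?case by (simp only: ereal_divide if_False)
  qed
  then have "total_dof h \<le> Limsup at_top (\<lambda>P. ereal ((4 / 3 * (1 / 2 * log 2 P) + C) / (1 / 2 * log 2 P)))"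
    unfolding total_dof_def by (rule Limsup_mono)
  also have "\<dots> = ereal (4 / 3)"
  proof (intro lim_imp_Limsup tendsto_ereal)
    show "((\<lambda>P. (4 / 3 * (1 / 2 * log 2 P) + C) / (1 / 2 * log 2 P)) \<longlongrightarrow> 4 / 3) at_top"
      by real_asymp
  qed simp
  finally show ?thesis .
qed

section \<open>The exceptional set\<close>

text \<open>Padding with empty sets, which weigh 0, makes a finite cover a sequence.\<close>

lemma hausdorff_premeasure_le_finite_cover:
  assumes fin: "finite \<C>" and cov: "S \<subseteq> \<Union>\<C>"
    and C: "\<And>U. U \<in> \<C> \<Longrightarrow> bounded U \<and> diameter U \<le> d" and "0 \<le> d" "d \<le> \<delta>" "0 < s"
  shows "hausdorff_premeasure s \<delta> S \<le> ennreal (card \<C> * d powr s)"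
proof -
  obtain f where f: "bij_betw f {..<card \<C>} \<C>"
    using ex_bij_betw_nat_finite[OF fin] by (auto simp: atLeast0LessThan)
  define U where "U n = (if n < card \<C> then f n else {})" for n
  have U: "bounded (U n) \<and> diameter (U n) \<le> d" for n
    using C[of "f n"] bij_betwE[OF f] \<open>0 \<le> d\<close> by (auto simp: U_def)
  have "S \<subseteq> (\<Union>n. U n)"
  proof
    fix x assume "x \<in> S"
    then obtain A where A: "A \<in> \<C>" "x \<in> A" using cov by auto
    then obtain n where "n < card \<C>" "f n = A"
      using bij_betw_imp_surj_on[OF f] by (metis imageE lessThan_iff)
    then show "x \<in> (\<Union>n. U n)" using A by (auto simp: U_def intro!: exI[of _ n])
  qed
  then have "U \<in> delta_covers \<delta> S"
    using U \<open>d \<le> \<delta>\<close> by (auto simp: delta_covers_def intro: order_trans)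
  then have "hausdorff_premeasure s \<delta> S \<le> (\<Sum>n. hausdorff_weight s (U n))"
    unfolding hausdorff_premeasure_def by (rule INF_lower)
  also have "\<dots> = (\<Sum>n<card \<C>. hausdorff_weight s (U n))"
    by (intro suminf_finite) (auto simp: U_def hausdorff_weight_def)
  also have "\<dots> \<le> (\<Sum>n<card \<C>. ennreal (d powr s))"
    using U \<open>0 < s\<close> by (intro sum_mono)
      (auto simp: hausdorff_weight_def intro!: ennreal_leI powr_mono2 diameter_ge_0)
  also have "\<dots> = ennreal (card \<C> * d powr s)"
    by (simp add: ennreal_of_nat_eq_real_of_nat ennreal_mult')
  finally show ?thesis .
qed

text \<open>The set \<open>A n\<close> gets a cover of weight below \<open>e / 2^(n+1)\<close>; a
  pairing bijection merges these covers into one sequence of total weight at most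
  \<open>e\<close>.\<close>

lemma hausdorff_premeasure_UN_0:
  assumes "\<And>n. hausdorff_premeasure s \<delta> (A n) = 0"
  shows "hausdorff_premeasure s \<delta> (\<Union>n::nat. A n) = 0"
proof -
  have "hausdorff_premeasure s \<delta> (\<Union>n. A n) \<le> ennreal e" if e: "0 < e" for e :: real
  proof -
    have "\<exists>U\<in>delta_covers \<delta> (A n). (\<Sum>k. hausdorff_weight s (U k)) < ennreal (e * (1 / 2) ^ Suc n)" for n
      using assms[of n] e unfolding hausdorff_premeasure_def
      by (subst INF_less_iff[symmetric]) simp
    then obtain U where U: "\<And>n. U n \<in> delta_covers \<delta> (A n)"
      "\<And>n. (\<Sum>k. hausdorff_weight s (U n k)) < ennreal (e * (1 / 2) ^ Suc n)" by metis
    define V where "V k = case_prod U (prod_decode k)" for k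
    have "V \<in> delta_covers \<delta> (\<Union>n. A n)"
    proof -
      have "x \<in> (\<Union>k. V k)" if "x \<in> A n" for x n
      proof -
        have "A n \<subseteq> (\<Union>k. U n k)" using U(1)[of n] by (simp add: delta_covers_def)
        with that obtain k where "x \<in> U n k" by blast
        then have "x \<in> V (prod_encode (n, k))" by (simp add: V_def)
        then show ?thesis by blast
      qed
      then show ?thesis using U(1) by (auto simp: delta_covers_def V_def split: prod.splits)
    qed
    then have "hausdorff_premeasure s \<delta> (\<Union>n. A n) \<le> (\<Sum>k. hausdorff_weight s (V k))"
      unfolding hausdorff_premeasure_def by (rule INF_lower)
    also have "\<dots> = (\<Sum>k. case_prod (\<lambda>n m. hausdorff_weight s (U n m)) (prod_decode k))"
      by (simp add: V_def case_prod_unfold)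
    also have "\<dots> = (\<Sum>n. \<Sum>k. hausdorff_weight s (U n k))"
      by (subst suminf_ennreal_2dimen[where f = "\<lambda>(n, m). hausdorff_weight s (U n m)", OF refl])
        (simp add: comp_def case_prod_unfold)
    also have "\<dots> \<le> (\<Sum>n. ennreal (e * (1 / 2) ^ Suc n))"
      using U(2) by (intro suminf_le) (auto intro: less_imp_le)
    also have "\<dots> = ennreal (e * 1)"
      using e by (intro suminf_ennreal_eq sums_mult power_half_series) auto
    finally show ?thesis by simp
  qed
  then show ?thesis
    by (metis ennreal_le_epsilon add_0 le_zero_eq)
qed

lemma hausdorff_dim_leI:
  assumes "0 \<le> s" "\<And>\<delta>. 0 < \<delta> \<Longrightarrow> hausdorff_premeasure s \<delta> S = 0"
  shows "hausdorff_dim S \<le> ereal s"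
  unfolding hausdorff_dim_def
  using assms by (intro INF_lower) (auto simp: hausdorff_measure_def)

lemma norm_real22_le:
  fixes v :: "real^2^2"
  assumes "\<And>i j. \<bar>v $ i $ j\<bar> \<le> c"
  shows "norm v \<le> 4 * c"
proof -
  have "norm v \<le> (\<Sum>i\<in>UNIV. norm (v $ i))"
    unfolding norm_vec_def by (rule L2_set_le_sum) simp
  also have "\<dots> \<le> (\<Sum>i\<in>(UNIV :: 2 set). \<Sum>j\<in>(UNIV :: 2 set). \<bar>v $ i $ j\<bar>)"
    by (intro sum_mono norm_le_l1_cart)
  also have "\<dots> \<le> (\<Sum>i\<in>(UNIV :: 2 set). \<Sum>j\<in>(UNIV :: 2 set). c)"
    by (intro sum_mono assms)
  finally show ?thesis by simp
qed

text \<open>The difference telescopes, one of \<open>a\<close>, \<open>b\<close>,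
  \<open>1 / c\<close> changing at a time. This supplies the Lipschitz constant of the fourth
  coefficient as a function of the other three.\<close>

lemma quotient_diff_bound:
  fixes m :: real
  assumes m: "1 \<le> m" and a: "0 \<le> a" "a \<le> m" "0 \<le> a'" "a' \<le> m"
    and b: "0 \<le> b" "b \<le> m" "0 \<le> b'" "b' \<le> m" and c: "1 / m \<le> c" "1 / m \<le> c'"
    and d: "\<bar>a - a'\<bar> \<le> e" "\<bar>b - b'\<bar> \<le> e" "\<bar>c - c'\<bar> \<le> e"
  shows "\<bar>a * b / c - a' * b' / c'\<bar> \<le> 3 * m ^ 4 * e"
proof -
  have c0: "0 < c" "0 < c'" using c m by (auto intro: less_le_trans[of 0 "1/m"])
  have ic: "1 / c \<le> m" "1 / c' \<le> m" using c c0 m by (auto simp: field_simps)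
  have e0: "0 \<le> e" using d(1) by linarith
  have "a * b / c - a' * b' / c' = (a - a') * (b * (1 / c)) + a' * ((b - b') * (1 / c)) + (a' * b') * ((c' - c) * ((1 / c) * (1 / c')))"
    using c0 by (simp add: field_simps)
  also have "\<bar>\<dots>\<bar> \<le> \<bar>(a - a') * (b * (1 / c))\<bar> + \<bar>a' * ((b - b') * (1 / c))\<bar> + \<bar>(a' * b') * ((c' - c) * ((1 / c) * (1 / c')))\<bar>"
    by linarith
  also have "\<dots> \<le> e * (m * m) + m * (e * m) + (m * m) * (e * (m * m))"
    unfolding abs_mult using a b c0 ic d e0 m
    by (intro add_mono mult_mono) auto
  also have "\<dots> \<le> 3 * m ^ 4 * e"
  proof -
    have "m ^ 2 \<le> m ^ 4" using m by (intro power_increasing) auto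
    then have "e * m ^ 2 \<le> e * m ^ 4" using e0 by (intro mult_left_mono)
    then show ?thesis by (simp add: power2_eq_square power4_eq_xxxx algebra_simps)
  qed
  finally show ?thesis .
qed

text \<open>Keeping the entries in \<open>[1/m, m]\<close> bounds the piece and keeps the
  denominator \<open>h $ 1 $ 1\<close> away from 0.\<close>

definition ratio_piece :: "real \<Rightarrow> real \<Rightarrow> (real^2^2) set" where
  "ratio_piece q m = {h. (\<forall>i j. 1 / m \<le> h $ i $ j \<and> h $ i $ j \<le> m) \<and>
     h $ 1 $ 2 * h $ 2 $ 1 = q * (h $ 1 $ 1 * h $ 2 $ 2)}"

text \<open>The piece is the graph of a Lipschitz function of three of the coefficients.\<close>

lemma hausdorff_premeasure_ratio_piece:
  assumes q: "0 < q" and m: "1 \<le> m" and \<delta>: "0 < \<delta>"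
  shows "hausdorff_premeasure (11 / 3) \<delta> (ratio_piece q m) = 0"
proof -
  \<comment> \<open>The factor 4 comes from \<open>norm_real22_le\<close>, the 1 from the three free
    coefficients, and \<open>3 * m ^ 4 / q\<close> is the Lipschitz constant of
    \<open>h $ 2 $ 2\<close>.\<close>
  define K where "K = 4 * (1 + 3 * m ^ 4 / q)"
  define M where "M = nat \<lceil>m\<rceil> + 1"
  have M: "m \<le> M" "m < M" unfolding M_def by linarith+
  have K: "0 < K" using q m by (simp add: K_def add_pos_pos)
  \<comment> \<open>The index of the cube of side \<open>1 / n\<close> that contains the three free
    coefficients.\<close>
  define key where "key n h = (\<lfloor>real n * h $ 1 $ 1\<rfloor>, \<lfloor>real n * h $ 1 $ 2\<rfloor>, \<lfloor>real n * h $ 2 $ 1\<rfloor>)" for n :: nat and h :: "real^2^2"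
  have bound: "hausdorff_premeasure (11 / 3) \<delta> (ratio_piece q m) \<le>
      ennreal ((n * M + 1) ^ 3 * (K / n) powr (11 / 3))"
    if n: "1 \<le> n" "K / n \<le> \<delta>" for n :: nat
  proof -
    define Z where "Z = {0..int (n * M)} \<times> {0..int (n * M)} \<times> {0..int (n * M)}"
    define cell where "cell z = {h \<in> ratio_piece q m. key n h = z}" for z
    have fl: "0 \<le> \<lfloor>real n * x\<rfloor> \<and> \<lfloor>real n * x\<rfloor> \<le> int (n * M)" if "1 / m \<le> x" "x \<le> m" for x
    proof -
      have "0 \<le> x" using that m by (auto intro: order_trans[of 0 "1/m"])
      moreover have "real n * x \<le> real n * real M" using that M by (intro mult_left_mono) auto
      then have "\<lfloor>real n * x\<rfloor> \<le> \<lfloor>real (n * M)\<rfloor>" by (intro floor_mono) simp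
      then have "\<lfloor>real n * x\<rfloor> \<le> int (n * M)" by (simp only: floor_of_nat)
      ultimately show ?thesis by simp
    qed
    have key: "key n h \<in> Z" if "h \<in> ratio_piece q m" for h
      using that fl by (auto simp: ratio_piece_def key_def Z_def)
    have cov: "ratio_piece q m \<subseteq> \<Union>(cell ` Z)"
      using key by (auto simp: cell_def)
    have dist: "dist h h' \<le> K / n" if "h \<in> cell z" "h' \<in> cell z" for h h' z
    proof -
      have h: "h \<in> ratio_piece q m" "h' \<in> ratio_piece q m" "key n h = key n h'"
        using that by (auto simp: cell_def)
      have fe: "\<bar>x - y\<bar> \<le> 1 / n" if "\<lfloor>real n * x\<rfloor> = \<lfloor>real n * y\<rfloor>" for x y
      proof -
        have "\<bar>real n * x - real n * y\<bar> \<le> 1" using that by linarith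
        then have "real n * \<bar>x - y\<bar> \<le> 1" by (simp flip: right_diff_distrib add: abs_mult)
        then show ?thesis using n by (simp add: field_simps)
      qed
      have d: "\<bar>h $ 1 $ 1 - h' $ 1 $ 1\<bar> \<le> 1 / n" "\<bar>h $ 1 $ 2 - h' $ 1 $ 2\<bar> \<le> 1 / n" "\<bar>h $ 2 $ 1 - h' $ 2 $ 1\<bar> \<le> 1 / n"
        using h(3) by (auto simp: key_def intro!: fe)
      have rng: "1 / m \<le> v $ i $ j" "v $ i $ j \<le> m" "0 < v $ i $ j" if "v \<in> {h, h'}" for v i j
      proof -
        show 1: "1 / m \<le> v $ i $ j" "v $ i $ j \<le> m" using that h by (auto simp: ratio_piece_def)
        then show "0 < v $ i $ j" using m by (auto intro: less_le_trans[of 0 "1/m"])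
      qed
      have eq: "v $ 2 $ 2 = (v $ 1 $ 2 * v $ 2 $ 1 / v $ 1 $ 1) / q" if "v \<in> {h, h'}" for v
        using that h q rng(3)[OF that, of 1 1] by (auto simp: ratio_piece_def)
      have "\<bar>h $ 1 $ 2 * h $ 2 $ 1 / h $ 1 $ 1 - h' $ 1 $ 2 * h' $ 2 $ 1 / h' $ 1 $ 1\<bar> \<le> 3 * m ^ 4 * (1 / n)"
        using rng[of h] rng[of h'] d m
        by (intro quotient_diff_bound) (auto intro: less_imp_le)
      then have "\<bar>h $ 2 $ 2 - h' $ 2 $ 2\<bar> \<le> 3 * m ^ 4 * (1 / n) / q"
        unfolding eq[OF insertI1] eq[OF insertI2[OF singletonI]] diff_divide_distrib[symmetric] abs_divide
        using q by (simp only: abs_of_pos divide_right_mono less_imp_le)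
      also have "\<dots> \<le> (1 + 3 * m ^ 4 / q) * (1 / n)"
        using q n by (simp add: field_simps)
      finally have d22: "\<bar>h $ 2 $ 2 - h' $ 2 $ 2\<bar> \<le> (1 + 3 * m ^ 4 / q) * (1 / n)" .
      have "1 / n \<le> (1 + 3 * m ^ 4 / q) * (1 / n)"
        using q m mult_right_mono[of 1 "1 + 3 * m ^ 4 / q" "1 / real n"] by simp
      then have "\<bar>(h - h') $ i $ j\<bar> \<le> (1 + 3 * m ^ 4 / q) * (1 / n)" for i j
        using d d22 exhaust_2[of i] exhaust_2[of j] by auto
      then have "norm (h - h') \<le> 4 * ((1 + 3 * m ^ 4 / q) * (1 / n))" by (rule norm_real22_le)
      then show ?thesis by (simp add: dist_norm K_def)
    qed
    have cell: "bounded (cell z) \<and> diameter (cell z) \<le> K / n" for z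
    proof
      show "diameter (cell z) \<le> K / n"
        using dist[of _ z] K n by (intro diameter_le) (auto simp: dist_norm)
      show "bounded (cell z)"
        unfolding bounded_two_points using dist by blast
    qed
    have finZ: "finite Z" by (simp add: Z_def)
    have "hausdorff_premeasure (11 / 3) \<delta> (ratio_piece q m) \<le> ennreal (card (cell ` Z) * (K / n) powr (11 / 3))"
      using cov cell n K finZ
      by (intro hausdorff_premeasure_le_finite_cover) auto
    also have "\<dots> \<le> ennreal ((n * M + 1) ^ 3 * (K / n) powr (11 / 3))"
    proof (intro ennreal_leI mult_right_mono)
      have "card (cell ` Z) \<le> card Z" by (rule card_image_le[OF finZ])
      also have "card Z = (n * M + 1) ^ 3"
        by (simp add: Z_def card_cartesian_product power3_eq_cube nat_add_distrib nat_mult_distrib)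
      finally show "real (card (cell ` Z)) \<le> real ((n * M + 1) ^ 3)" by (simp only: of_nat_le_iff)
    qed simp
    finally show ?thesis by simp
  qed
  have "0 < real M" by (simp add: M_def)
  \<comment> \<open>About \<open>n^3\<close> cells of diameter at most \<open>K / n\<close> have
    total weight of order \<open>n^(3 - 11/3)\<close>.\<close>
  then have lim: "(\<lambda>n. (real n * real M + 1) ^ 3 * (K / real n) powr (11 / 3)) \<longlonglongrightarrow> 0"
    using K by real_asymp
  have "eventually (\<lambda>n. K / real n < \<delta>) sequentially"
    using K \<delta> by real_asymp
  then have ev: "eventually (\<lambda>n. hausdorff_premeasure (11 / 3) \<delta> (ratio_piece q m) \<le>
      ennreal ((real n * real M + 1) ^ 3 * (K / real n) powr (11 / 3))) sequentially"
    using eventually_ge_at_top[of 1] by eventually_elim (use bound in \<open>auto simp: add.commute\<close>)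
  have "(\<lambda>n. ennreal ((real n * real M + 1) ^ 3 * (K / real n) powr (11 / 3))) \<longlonglongrightarrow> ennreal 0"
    using lim by (intro tendsto_ennrealI)
  then have "hausdorff_premeasure (11 / 3) \<delta> (ratio_piece q m) \<le> ennreal 0"
    using ev by (intro tendsto_lowerbound) auto
  then show ?thesis by simp
qed

definition rational_ratio_set :: "(real^2^2) set" where
  "rational_ratio_set = {h. (\<forall>i j. 0 < h $ i $ j) \<and> h $ 1 $ 2 * h $ 2 $ 1 / (h $ 1 $ 1 * h $ 2 $ 2) \<in> \<rat>}"

text \<open>The set is covered by countably many pieces, indexed by the fraction
  \<open>a / b\<close> and the size bound of the entries; each has premeasure 0 at exponent
  \<open>11 / 3 = 4 - 1 / 3\<close>.\<close>

lemma hausdorff_dim_rational_ratio_set: "hausdorff_dim rational_ratio_set \<le> ereal (4 - 1 / 3)"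
proof -
  have "hausdorff_premeasure (11 / 3) \<delta> rational_ratio_set = 0" if \<delta>: "0 < \<delta>" for \<delta>
  proof -
    \<comment> \<open>Ratio 0 and denominator 0 are given the empty set: the bound for pieces
      requires a positive ratio.\<close>
    define pc where "pc a b m = (if a = 0 \<or> b = (0::nat) then {} else ratio_piece (real a / real b) (real (Suc m)))" for a b m :: nat
    define p where "p n = (case prod_decode n of (a, c) \<Rightarrow> case prod_decode c of (b, m) \<Rightarrow> pc a b m)" for n
    have "hausdorff_premeasure (11 / 3) \<delta> ({} :: (real^2^2) set) = 0"
      using hausdorff_premeasure_le_finite_cover[of "{}" "{} :: (real^2^2) set" 0 \<delta> "11/3"] \<delta> by simp
    then have "hausdorff_premeasure (11 / 3) \<delta> (pc a b m) = 0" for a b m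
      using \<delta> by (auto simp: pc_def intro!: hausdorff_premeasure_ratio_piece)
    then have "hausdorff_premeasure (11 / 3) \<delta> (p n) = 0" for n
      by (auto simp: p_def split: prod.splits)
    then have 0: "hausdorff_premeasure (11 / 3) \<delta> (\<Union>n. p n) = 0" by (rule hausdorff_premeasure_UN_0)
    have "rational_ratio_set \<subseteq> (\<Union>n. p n)"
    proof
      fix h :: "real^2^2" assume "h \<in> rational_ratio_set"
      then have h: "\<And>i j. 0 < h $ i $ j" and "h $ 1 $ 2 * h $ 2 $ 1 / (h $ 1 $ 1 * h $ 2 $ 2) \<in> \<rat>"
        by (auto simp: rational_ratio_set_def)
      then obtain a b :: nat where ab: "b \<noteq> 0" "\<bar>h $ 1 $ 2 * h $ 2 $ 1 / (h $ 1 $ 1 * h $ 2 $ 2)\<bar> = real a / real b"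
        by (elim Rats_abs_nat_div_natE) auto
      have pos: "0 < h $ 1 $ 2 * h $ 2 $ 1 / (h $ 1 $ 1 * h $ 2 $ 2)" using h by simp
      have eq: "h $ 1 $ 2 * h $ 2 $ 1 / (h $ 1 $ 1 * h $ 2 $ 2) = real a / real b"
        using ab(2) unfolding abs_of_pos[OF pos] .
      with pos have a: "a \<noteq> 0" by (metis div_0 less_irrefl of_nat_0)
      \<comment> \<open>This sum dominates every entry and the reciprocal of every entry.\<close>
      define m where "m = nat \<lceil>\<Sum>i\<in>UNIV. \<Sum>j\<in>UNIV. h $ i $ j + 1 / h $ i $ j\<rceil>"
      have "1 / real (Suc m) \<le> h $ i $ j \<and> h $ i $ j \<le> real (Suc m)" for i j
      proof -
        have pos: "0 < h $ i $ j + 1 / h $ i $ j" for i j using h by (simp add: add_pos_pos)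
        have "h $ i $ j + 1 / h $ i $ j \<le> (\<Sum>j\<in>UNIV. h $ i $ j + 1 / h $ i $ j)"
          using pos by (intro member_le_sum) (auto intro: less_imp_le)
        also have "\<dots> \<le> (\<Sum>i\<in>UNIV. \<Sum>j\<in>UNIV. h $ i $ j + 1 / h $ i $ j)"
          using pos by (intro member_le_sum[of i UNIV "\<lambda>i. \<Sum>j\<in>UNIV. h $ i $ j + 1 / h $ i $ j"]) (auto intro!: sum_nonneg order.strict_implies_order[OF pos])
        also have "\<dots> \<le> real (Suc m)" unfolding m_def by linarith
        finally have "h $ i $ j + 1 / h $ i $ j \<le> real (Suc m)" .
        moreover have "0 < h $ i $ j" "0 < 1 / h $ i $ j" using h by auto
        ultimately have "h $ i $ j \<le> real (Suc m)" "1 / h $ i $ j \<le> real (Suc m)" by linarith+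
        then show ?thesis using h[of i j] by (simp add: field_simps del: of_nat_Suc)
      qed
      moreover have "h $ 1 $ 2 * h $ 2 $ 1 = real a / real b * (h $ 1 $ 1 * h $ 2 $ 2)"
        using eq h[of 1 1] h[of 2 2] by (simp only: divide_eq_eq) simp
      ultimately have "h \<in> pc a b m" using a ab by (auto simp: pc_def ratio_piece_def simp del: of_nat_Suc)
      then have "h \<in> p (prod_encode (a, prod_encode (b, m)))" by (simp add: p_def)
      then show "h \<in> (\<Union>n. p n)" by blast
    qed
    then have "hausdorff_premeasure (11 / 3) \<delta> rational_ratio_set \<le> hausdorff_premeasure (11 / 3) \<delta> (\<Union>n. p n)"
      unfolding hausdorff_premeasure_def by (intro INF_superset_mono) (auto simp: delta_covers_def)
    then show ?thesis using 0 by simp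
  qed
  then have "hausdorff_dim rational_ratio_set \<le> ereal (11 / 3)" by (intro hausdorff_dim_leI) auto
  then show ?thesis by simp
qed

section \<open>Diophantine separation and the outer code\<close>

text \<open>Take \<open>Q\<close> to be a denominator at which the record distance to the integers drops; below it the
  previous record is still in force.\<close>

lemma irrational_good_denominators:
  fixes \<rho> :: real
  assumes irr: "\<rho> \<notin> \<rat>"
  shows "\<exists>Q\<ge>Q0. \<forall>a b :: int. b \<noteq> 0 \<and> \<bar>b\<bar> < int Q \<longrightarrow> 1 / (2 * real Q) \<le> \<bar>real_of_int a + \<rho> * real_of_int b\<bar>"
proof -
  \<comment> \<open>The distance from \<open>\<rho> * q\<close> to the nearest integer.\<close>
  define f where "f q = \<bar>\<rho> * real q - of_int (round (\<rho> * real q))\<bar>" for q :: nat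
  have fpos: "0 < f q" if "0 < q" for q
  proof (rule ccontr)
    assume "\<not> 0 < f q"
    then have "\<rho> * real q = of_int (round (\<rho> * real q))" by (simp add: f_def)
    then have "\<rho> = of_int (round (\<rho> * real q)) / of_int (int q)" using that by (simp add: field_simps)
    then have "\<rho> \<in> \<rat>" using Rats_divide[OF Rats_of_int Rats_of_int] by metis
    then show False using irr by simp
  qed
  have fin: "finite (f ` {1..Suc Q0})" "f ` {1..Suc Q0} \<noteq> {}" by auto
  \<comment> \<open>The record over all denominators up to \<open>Q0 + 1\<close>; any denominator
    that beats it must be larger than that.\<close>
  define \<delta> where "\<delta> = Min (f ` {1..Suc Q0})"
  have "\<delta> \<in> f ` {1..Suc Q0}" unfolding \<delta>_def by (rule Min_in[OF fin])
  then obtain q where q: "1 \<le> q" "q \<le> Suc Q0" "f q = \<delta>" by auto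
  have "0 < \<delta>" using q fpos[of q] by simp
  obtain n where n: "0 < n" "1 / real n < \<delta>"
    using \<open>0 < \<delta>\<close> by (metis nat_approx_posE zero_less_Suc)
  \<comment> \<open>Dirichlet's theorem shows that the record is beaten, so that the least such
    denominator \<open>Q\<close> exists.\<close>
  obtain p k where k: "0 < k" "\<bar>of_int k * \<rho> - of_int p\<bar> < 1 / real n"
    using Dirichlet_approx[OF n(1), of \<rho>] by blast
  have "f (nat k) \<le> \<bar>\<rho> * real (nat k) - of_int p\<bar>"
    unfolding f_def by (rule round_diff_minimal)
  also have "\<dots> < \<delta>" using k n by (simp add: mult.commute)
  finally have ex: "1 \<le> nat k \<and> f (nat k) < \<delta>" using k by simp
  define Q where "Q = (LEAST k. 1 \<le> k \<and> f k < \<delta>)"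
  have Q: "1 \<le> Q" "f Q < \<delta>" using LeastI[of "\<lambda>k. 1 \<le> k \<and> f k < \<delta>", OF ex] by (auto simp: Q_def)
  have below: "\<delta> \<le> f r" if "1 \<le> r" "r < Q" for r
    using not_less_Least[of r "\<lambda>k. 1 \<le> k \<and> f k < \<delta>"] that by (auto simp: Q_def)
  have "Suc Q0 < Q"
  proof (rule ccontr)
    assume "\<not> Suc Q0 < Q"
    then have "\<delta> \<le> f Q" unfolding \<delta>_def using Q by (intro Min_le fin) auto
    then show False using Q by simp
  qed
  define P where "P = round (\<rho> * real Q)"
  define p where "p = round (\<rho> * real q)"
  \<comment> \<open>The determinant of the two approximations. If it vanished,
    \<open>q * f Q = Q * f q\<close> would contradict \<open>f Q < f q\<close> and
    \<open>q < Q\<close>. As a nonzero integer it has modulus at least 1, while it is at most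
    \<open>Q * f q + q * f Q \<le> 2 * Q * \<delta>\<close>.\<close>
  have "int q * P \<noteq> int Q * p"
  proof
    assume "int q * P = int Q * p"
    then have "real_of_int (int q * P) = real_of_int (int Q * p)" by (rule arg_cong)
    then have eq: "real q * of_int P = real Q * of_int p" by simp
    have "real q * f Q = \<bar>real q * (\<rho> * real Q) - real q * of_int P\<bar>"
      unfolding f_def P_def by (simp add: abs_mult flip: right_diff_distrib)
    also have "\<dots> = \<bar>real Q * (\<rho> * real q) - real Q * of_int p\<bar>" unfolding eq by (simp add: ac_simps)
    also have "\<dots> = real Q * f q" unfolding f_def p_def by (simp add: abs_mult flip: right_diff_distrib)
    finally have "real q * f Q = real Q * \<delta>" using q by simp
    moreover have "real q * f Q < real q * \<delta>" using q Q by simp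
    moreover have "real q * \<delta> \<le> real Q * \<delta>" using q \<open>Suc Q0 < Q\<close> \<open>0 < \<delta>\<close> by simp
    ultimately show False by simp
  qed
  then have "1 \<le> \<bar>int q * P - int Q * p\<bar>" by linarith
  then have "real_of_int 1 \<le> real_of_int \<bar>int q * P - int Q * p\<bar>" by (simp only: of_int_le_iff)
  then have "1 \<le> \<bar>real q * of_int P - real Q * of_int p\<bar>" by simp
  also have "real q * of_int P - real Q * of_int p =
      real Q * (\<rho> * real q - of_int p) - real q * (\<rho> * real Q - of_int P)" by (simp add: algebra_simps)
  also have "\<bar>\<dots>\<bar> \<le> real Q * f q + real q * f Q"
    unfolding f_def p_def P_def by (rule order_trans[OF abs_triangle_ineq4]) (simp add: abs_mult)
  also have "\<dots> \<le> real Q * \<delta> + real Q * \<delta>"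
    using q Q \<open>Suc Q0 < Q\<close> fpos[of Q] by (intro add_mono mult_mono) auto
  finally have \<delta>: "1 / (2 * real Q) \<le> \<delta>" using Q by (simp add: field_simps)
  have "1 / (2 * real Q) \<le> \<bar>real_of_int a + \<rho> * real_of_int b\<bar>" if b: "b \<noteq> 0" "\<bar>b\<bar> < int Q" for a b :: int
  proof -
    have "\<delta> \<le> f (nat \<bar>b\<bar>)" by (rule below) (use b in linarith)+
    with \<delta> have "1 / (2 * real Q) \<le> f (nat \<bar>b\<bar>)" by linarith
    \<comment> \<open>Multiplying \<open>a\<close> and \<open>b\<close> by the sign of
      \<open>b\<close> makes the denominator positive.\<close>
    also have "\<dots> \<le> \<bar>\<rho> * real (nat \<bar>b\<bar>) - of_int (- (sgn b * a))\<bar>" unfolding f_def by (rule round_diff_minimal)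
    also have "\<dots> = \<bar>real_of_int a + \<rho> * real_of_int b\<bar>" using b by (cases "0 < b") auto
    finally show ?thesis .
  qed
  then show ?thesis using \<open>Suc Q0 < Q\<close> by (intro exI[of _ Q]) auto
qed

section \<open>A scale that separates the points at both receivers\<close>

text \<open>For one \<open>c\<close> the bad \<open>s\<close> lie in an interval of length
  \<open>2 * \<delta> / \<bar>L\<bar>\<close>, and at most about
  \<open>\<bar>L\<bar> / \<mu> + 1\<close> values of \<open>c\<close> matter while \<open>s\<close>
  runs through \<open>[1,2]\<close>. The product stays bounded for large
  \<open>\<bar>L\<bar>\<close>, so all \<open>c\<close> together cost only a multiple of
  \<open>\<delta>\<close>.\<close>

lemma bad_scales_cover:
  fixes L \<theta> \<mu> \<eta> \<delta> :: real
  assumes "0 < \<mu>" "0 < \<eta>" "\<eta> \<le> \<bar>L\<bar>" "0 < \<delta>" "\<delta> \<le> 1"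
  shows "\<exists>T\<in>sets lborel. {s\<in>{1..2}. \<exists>c::int. \<bar>s * L + \<theta> + \<mu> * of_int c\<bar> < \<delta>} \<subseteq> T \<and>
    emeasure lborel T \<le> ennreal (\<delta> * (2 / \<mu> + 4 / (\<mu> * \<eta>) + 2 / \<eta>))"
proof -
  define lo where "lo = - \<theta> - max L (2 * L) - \<delta>"
  define hi where "hi = - \<theta> - min L (2 * L) + \<delta>"
  define C where "C = {\<lceil>lo / \<mu>\<rceil>..\<lfloor>hi / \<mu>\<rfloor>}"
  define J where "J c = {- (\<theta> + \<mu> * of_int c) / L - \<delta> / \<bar>L\<bar> <..< - (\<theta> + \<mu> * of_int c) / L + \<delta> / \<bar>L\<bar>}" for c :: int
  have L: "0 < \<bar>L\<bar>" using assms by linarith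
  have hl: "hi - lo = \<bar>L\<bar> + 2 * \<delta>" by (simp add: hi_def lo_def max_def min_def)
  have "real (card C) \<le> (hi - lo) / \<mu> + 1"
  proof -
    have "0 \<le> (hi - lo) / \<mu> + 1" using hl L assms by simp
    moreover have "real_of_int (\<lfloor>hi / \<mu>\<rfloor> + 1 - \<lceil>lo / \<mu>\<rceil>) \<le> hi / \<mu> - lo / \<mu> + 1" by linarith
    ultimately show ?thesis by (simp add: C_def diff_divide_distrib)
  qed
  have sub: "{s\<in>{1..2}. \<exists>c::int. \<bar>s * L + \<theta> + \<mu> * of_int c\<bar> < \<delta>} \<subseteq> (\<Union>c\<in>C. J c)"
  proof safe
    fix s :: real and c :: int assume s: "s \<in> {1..2}" and c: "\<bar>s * L + \<theta> + \<mu> * of_int c\<bar> < \<delta>"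
    have sL: "min L (2 * L) \<le> s * L \<and> s * L \<le> max L (2 * L)"
    proof (cases "0 \<le> L")
      case True
      then show ?thesis using s mult_right_mono[of 1 s L] mult_right_mono[of s 2 L] by auto
    next
      case False
      then show ?thesis using s mult_right_mono_neg[of 1 s L] mult_right_mono_neg[of s 2 L] by auto
    qed
    have "lo \<le> \<mu> * of_int c" "\<mu> * of_int c \<le> hi" using c sL unfolding lo_def hi_def by linarith+
    then have "c \<in> C" using assms(1) by (simp add: C_def ceiling_le_iff le_floor_iff field_simps)
    moreover have "s \<in> J c"
    proof -
      have "s * L + \<theta> + \<mu> * of_int c = L * (s - - (\<theta> + \<mu> * of_int c) / L)"
        using L by (simp add: field_simps)
      then have "\<bar>s * L + \<theta> + \<mu> * of_int c\<bar> = \<bar>L\<bar> * \<bar>s - - (\<theta> + \<mu> * of_int c) / L\<bar>"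
        by (simp only: abs_mult)
      then have "\<bar>s - - (\<theta> + \<mu> * of_int c) / L\<bar> < \<delta> / \<bar>L\<bar>" using c L by (simp only: pos_less_divide_eq mult.commute)
      then show ?thesis unfolding J_def by (simp only: greaterThanLessThan_iff) linarith
    qed
    ultimately show "s \<in> (\<Union>c\<in>C. J c)" by blast
  qed
  have "emeasure lborel (\<Union>c\<in>C. J c) \<le> (\<Sum>c\<in>C. emeasure lborel (J c))"
    by (intro emeasure_subadditive_finite) (auto simp: C_def J_def)
  also have "\<dots> = (\<Sum>c\<in>C. ennreal (2 * (\<delta> / \<bar>L\<bar>)))"
    using L assms by (intro sum.cong refl) (simp add: J_def)
  also have "\<dots> = ennreal (card C * (2 * (\<delta> / \<bar>L\<bar>)))"
    using L assms by (simp only: sum_constant ennreal_of_nat_eq_real_of_nat)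
      (rule ennreal_mult'[symmetric], simp)
  also have "\<dots> \<le> ennreal (\<delta> * (2 / \<mu> + 4 / (\<mu> * \<eta>) + 2 / \<eta>))"
  proof (intro ennreal_leI)
    have "card C * (2 * (\<delta> / \<bar>L\<bar>)) \<le> ((\<bar>L\<bar> + 2 * \<delta>) / \<mu> + 1) * (2 * (\<delta> / \<bar>L\<bar>))"
      using \<open>real (card C) \<le> _\<close> hl L assms by (intro mult_right_mono) auto
    also have "\<dots> = \<delta> * (2 / \<mu> + \<delta> * (4 / (\<mu> * \<bar>L\<bar>)) + 2 / \<bar>L\<bar>)"
      using L assms by (simp add: field_simps)
    also have "\<dots> \<le> \<delta> * (2 / \<mu> + 1 * (4 / (\<mu> * \<eta>)) + 2 / \<eta>)"
      using L assms by (intro mult_left_mono add_mono mult_mono divide_left_mono) auto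
    finally show "card C * (2 * (\<delta> / \<bar>L\<bar>)) \<le> \<delta> * (2 / \<mu> + 4 / (\<mu> * \<eta>) + 2 / \<eta>)" by simp
  qed
  finally have "emeasure lborel (\<Union>c\<in>C. J c) \<le> ennreal (\<delta> * (2 / \<mu> + 4 / (\<mu> * \<eta>) + 2 / \<eta>))" .
  moreover have "(\<Union>c\<in>C. J c) \<in> sets lborel" by (auto simp: C_def J_def)
  ultimately show ?thesis using sub by blast
qed

text \<open>A union bound. Of the three integers one is absorbed by \<open>bad_scales_cover\<close>:
  \<open>c\<close> at receiver 1 and \<open>b\<close> at receiver 2. So \<open>O(Q^2)\<close> bad
  sets of measure \<open>O(1/Q^2)\<close> remain instead of \<open>O(Q^3)\<close>, which is what
  permits a separation of order \<open>1/Q^2\<close>.\<close>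

lemma separating_scale:
  fixes \<rho> \<mu> \<nu> :: real
  assumes \<mu>: "0 < \<mu>" and \<nu>: "0 < \<nu>"
  shows "\<exists>c0>0. \<forall>Q::nat. 1 \<le> Q \<longrightarrow>
    (\<forall>a b :: int. b \<noteq> 0 \<and> \<bar>b\<bar> < int Q \<longrightarrow> 1 / (2 * real Q) \<le> \<bar>of_int a + \<rho> * of_int b\<bar>) \<longrightarrow>
    (\<exists>s\<in>{1..2}. \<forall>a b c :: int. \<bar>a\<bar> < int Q \<and> \<bar>b\<bar> < int Q \<and> \<bar>c\<bar> < 2 * int Q \<and> (a, b) \<noteq> (0, 0) \<longrightarrow>
      c0 / (real Q)\<^sup>2 \<le> \<bar>s * (of_int a + \<rho> * of_int b) + \<mu> * of_int c\<bar> \<and>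
      c0 / (real Q)\<^sup>2 \<le> \<bar>\<rho> * of_int a + of_int b + s * \<nu> * of_int c\<bar>)"
proof -
  define K where "K = (2 / \<mu> + 4 / (\<mu> * (\<mu> / 4)) + 2 / (\<mu> / 4)) + (2 / 1 + 4 / (1 * \<nu>) + 2 / \<nu>)"
  have K: "2 / \<mu> + 4 / (\<mu> * (\<mu> / 4)) + 2 / (\<mu> / 4) \<le> K" "2 / 1 + 4 / (1 * \<nu>) + 2 / \<nu> \<le> K" "0 < K"
    using \<mu> \<nu> by (auto simp: K_def intro!: add_pos_pos add_nonneg_nonneg)
  \<comment> \<open>At most \<open>12 * Q^2\<close> bad sets of measure at most
    \<open>c0 * K / Q^2\<close> have total measure at most \<open>12/13\<close>, less than the
    length of \<open>[1,2]\<close>. The bounds \<open>1 / 2\<close> and \<open>\<mu> / 2\<close>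
    serve the cases that need no bad set.\<close>
  define c0 where "c0 = min (1 / 2) (min (\<mu> / 2) (1 / (13 * K)))"
  have c0: "0 < c0" "c0 \<le> 1 / 2" "c0 \<le> \<mu> / 2" "c0 \<le> 1 / (13 * K)" using \<mu> K by (auto simp: c0_def)
  have "\<exists>s\<in>{1..2}. \<forall>a b c :: int. \<bar>a\<bar> < int Q \<and> \<bar>b\<bar> < int Q \<and> \<bar>c\<bar> < 2 * int Q \<and> (a, b) \<noteq> (0, 0) \<longrightarrow>
      c0 / (real Q)\<^sup>2 \<le> \<bar>s * (of_int a + \<rho> * of_int b) + \<mu> * of_int c\<bar> \<and>
      c0 / (real Q)\<^sup>2 \<le> \<bar>\<rho> * of_int a + of_int b + s * \<nu> * of_int c\<bar>"
    if Q: "1 \<le> Q" and dio: "\<And>a b :: int. b \<noteq> 0 \<Longrightarrow> \<bar>b\<bar> < int Q \<Longrightarrow> 1 / (2 * real Q) \<le> \<bar>of_int a + \<rho> * of_int b\<bar>" for Q :: nat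
  proof -
    define \<delta> where "\<delta> = c0 / (real Q)\<^sup>2"
    have Q0: "0 < Q" using Q by simp
    have Q2: "1 \<le> (real Q)\<^sup>2" "real Q \<le> (real Q)\<^sup>2" using Q by (auto simp: self_le_power)
    have "\<delta> \<le> c0 / 1" unfolding \<delta>_def using Q2 Q0 c0 by (intro divide_left_mono) auto
    moreover have "\<delta> \<le> (1 / 2) / real Q" unfolding \<delta>_def using Q2 Q c0 by (intro frac_le) auto
    moreover have "0 < \<delta>" using c0 Q0 by (simp add: \<delta>_def)
    ultimately have \<delta>: "0 < \<delta>" "\<delta> \<le> 1" "\<delta> \<le> \<mu> / 2" "\<delta> \<le> 1 / (2 * real Q)" "\<delta> \<le> 1 / 2"
      using c0 by (simp_all del: divide_divide_eq_left divide_divide_eq_right)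
    have dio': "1 / (2 * real Q) \<le> \<bar>of_int a + \<rho> * of_int b\<bar>"
      if "(a, b) \<noteq> (0, 0)" "\<bar>b\<bar> < int Q" for a b :: int
    proof (cases "b = 0")
      case True
      then have "1 \<le> \<bar>a\<bar>" using that by auto
      then have "1 \<le> \<bar>real_of_int a\<bar>" by linarith
      moreover have "1 / (2 * real Q) \<le> 1" using Q by simp
      ultimately show ?thesis using True by simp
    qed (use dio that in auto)
    have "\<exists>T\<in>sets lborel. emeasure lborel T \<le> ennreal (\<delta> * K) \<and>
        (\<forall>s\<in>{1..2} - T. \<forall>c. \<delta> \<le> \<bar>s * (of_int a + \<rho> * of_int b) + \<mu> * of_int c\<bar>)"
      if ab: "(a, b) \<noteq> (0, 0)" "\<bar>b\<bar> < int Q" for a b :: int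
    proof (cases "\<mu> / 4 \<le> \<bar>of_int a + \<rho> * of_int b\<bar>")
      case True
      obtain T where T: "T \<in> sets lborel"
        "{s\<in>{1..2}. \<exists>c::int. \<bar>s * (of_int a + \<rho> * of_int b) + 0 + \<mu> * of_int c\<bar> < \<delta>} \<subseteq> T"
        "emeasure lborel T \<le> ennreal (\<delta> * (2 / \<mu> + 4 / (\<mu> * (\<mu> / 4)) + 2 / (\<mu> / 4)))"
        using bad_scales_cover[OF \<mu> _ True \<delta>(1,2), of 0] \<mu> by auto
      have "emeasure lborel T \<le> ennreal (\<delta> * K)"
        using \<delta>(1) K by (intro order_trans[OF T(3)] ennreal_leI mult_left_mono) auto
      then show ?thesis using T(1,2) by (intro bexI[of _ T]) (auto simp: not_less[symmetric])
    next
      case False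
      \<comment> \<open>No scale is bad here: for \<open>c = 0\<close> the Diophantine bound
        suffices, and otherwise \<open>\<bar>\<mu> * c\<bar> \<ge> \<mu>\<close> outweighs the first
        term, which is at most \<open>\<mu> / 2\<close>.\<close>
      have "\<delta> \<le> \<bar>s * (of_int a + \<rho> * of_int b) + \<mu> * of_int c\<bar>" if s: "s \<in> {1..2}" for s and c :: int
      proof (cases "c = 0")
        case True
        have "\<delta> \<le> 1 * \<bar>of_int a + \<rho> * of_int b\<bar>" unfolding mult_1 by (rule order_trans[OF \<delta>(4) dio'[OF ab]])
        also have "\<dots> \<le> \<bar>s\<bar> * \<bar>of_int a + \<rho> * of_int b\<bar>" using s by (intro mult_right_mono) auto
        finally show ?thesis using True by (simp add: abs_mult)
      next
        case c: False
        have "\<mu> * 1 \<le> \<mu> * \<bar>of_int c\<bar>" using c \<mu> by (intro mult_left_mono) auto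
        then have "\<mu> \<le> \<bar>\<mu> * of_int c\<bar>" using \<mu> by (simp add: abs_mult)
        moreover have "\<bar>s * (of_int a + \<rho> * of_int b)\<bar> \<le> 2 * (\<mu> / 4)"
          unfolding abs_mult using s False by (intro mult_mono) auto
        ultimately show ?thesis using \<delta>(3) by linarith
      qed
      then show ?thesis using \<delta> K by (intro bexI[of _ "{}"]) auto
    qed
    then have "\<forall>a b :: int. \<exists>T. (a, b) \<noteq> (0, 0) \<and> \<bar>b\<bar> < int Q \<longrightarrow> T\<in>sets lborel \<and> emeasure lborel T \<le> ennreal (\<delta> * K) \<and>
        (\<forall>s\<in>{1..2} - T. \<forall>c. \<delta> \<le> \<bar>s * (of_int a + \<rho> * of_int b) + \<mu> * of_int c\<bar>)" by metis
    then obtain T1 where T1: "\<And>a b :: int. (a, b) \<noteq> (0, 0) \<Longrightarrow> \<bar>b\<bar> < int Q \<Longrightarrow> T1 a b\<in>sets lborel \<and> emeasure lborel (T1 a b) \<le> ennreal (\<delta> * K) \<and>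
        (\<forall>s\<in>{1..2} - T1 a b. \<forall>c. \<delta> \<le> \<bar>s * (of_int a + \<rho> * of_int b) + \<mu> * of_int c\<bar>)" by metis
    \<comment> \<open>At receiver 2 the scale multiplies \<open>\<nu> * c\<close>,
      \<open>\<rho> * a\<close> is a fixed shift, and \<open>b\<close> runs over all integers with
      step 1.\<close>
    have "\<exists>T\<in>sets lborel. emeasure lborel T \<le> ennreal (\<delta> * K) \<and>
        (\<forall>s\<in>{1..2} - T. \<forall>b. \<delta> \<le> \<bar>\<rho> * of_int a + of_int b + s * \<nu> * of_int c\<bar>)"
      if c: "c \<noteq> 0" for a c :: int
    proof -
      have "\<nu> * 1 \<le> \<nu> * \<bar>of_int c\<bar>" using c \<nu> by (intro mult_left_mono) auto
      then have c: "\<nu> \<le> \<bar>\<nu> * of_int c\<bar>" using \<nu> by (simp add: abs_mult)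
      obtain T where T: "T \<in> sets lborel"
        "{s\<in>{1..2}. \<exists>b::int. \<bar>s * (\<nu> * of_int c) + \<rho> * of_int a + 1 * of_int b\<bar> < \<delta>} \<subseteq> T"
        "emeasure lborel T \<le> ennreal (\<delta> * (2 / 1 + 4 / (1 * \<nu>) + 2 / \<nu>))"
        using bad_scales_cover[OF zero_less_one \<nu> c \<delta>(1,2), of "\<rho> * of_int a"] by blast
      have "emeasure lborel T \<le> ennreal (\<delta> * K)"
        using \<delta>(1) K by (intro order_trans[OF T(3)] ennreal_leI mult_left_mono) auto
      moreover have "\<delta> \<le> \<bar>\<rho> * of_int a + of_int b + s * \<nu> * of_int c\<bar>" if s: "s \<in> {1..2} - T" for s and b :: int
      proof -
        have "\<not> \<bar>s * (\<nu> * of_int c) + \<rho> * of_int a + 1 * of_int b\<bar> < \<delta>" using s T(2) by blast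
        then show ?thesis by (simp add: ac_simps)
      qed
      ultimately show ?thesis using T(1) by blast
    qed
    then have "\<forall>a c :: int. \<exists>T. c \<noteq> 0 \<longrightarrow> T \<in> sets lborel \<and> emeasure lborel T \<le> ennreal (\<delta> * K) \<and>
        (\<forall>s\<in>{1..2} - T. \<forall>b. \<delta> \<le> \<bar>\<rho> * of_int a + of_int b + s * \<nu> * of_int c\<bar>)" by metis
    then obtain T2 where T2: "\<And>a c :: int. c \<noteq> 0 \<Longrightarrow> T2 a c\<in>sets lborel \<and> emeasure lborel (T2 a c) \<le> ennreal (\<delta> * K) \<and>
        (\<forall>s\<in>{1..2} - T2 a c. \<forall>b. \<delta> \<le> \<bar>\<rho> * of_int a + of_int b + s * \<nu> * of_int c\<bar>)" by metis
    define I1 where "I1 = ({-int Q<..<int Q} \<times> {-int Q<..<int Q}) - {(0, 0)}"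
    define I2 where "I2 = {-int Q<..<int Q} \<times> ({-(2 * int Q)<..<2 * int Q} - {0})"
    have fin: "finite I1" "finite I2" by (auto simp: I1_def I2_def)
    have "card I1 \<le> card ({-int Q<..<int Q} \<times> {-int Q<..<int Q})" unfolding I1_def by (intro card_mono) auto
    also have "\<dots> \<le> (2 * Q) * (2 * Q)" unfolding card_cartesian_product by (intro mult_mono) auto
    finally have card1: "card I1 \<le> 4 * (Q * Q)" by simp
    have "card I2 \<le> card ({-int Q<..<int Q} \<times> {-(2 * int Q)<..<2 * int Q})" unfolding I2_def by (intro card_mono) auto
    also have "\<dots> \<le> (2 * Q) * (4 * Q)" unfolding card_cartesian_product by (intro mult_mono) auto
    finally have card2: "card I2 \<le> 8 * (Q * Q)" by simp
    define U1 where "U1 = (\<Union>x\<in>I1. T1 (fst x) (snd x))"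
    define U2 where "U2 = (\<Union>x\<in>I2. T2 (fst x) (snd x))"
    have S1: "T1 (fst x) (snd x) \<in> sets lborel \<and> emeasure lborel (T1 (fst x) (snd x)) \<le> ennreal (\<delta> * K)" if "x \<in> I1" for x
    proof -
      have "(fst x, snd x) \<noteq> (0, 0)" "\<bar>snd x\<bar> < int Q" using that by (auto simp: I1_def)
      then show ?thesis using T1 by blast
    qed
    have S2: "T2 (fst x) (snd x) \<in> sets lborel \<and> emeasure lborel (T2 (fst x) (snd x)) \<le> ennreal (\<delta> * K)" if "x \<in> I2" for x
      using that T2[of "snd x" "fst x"] by (auto simp: I2_def)
    have "emeasure lborel U1 \<le> (\<Sum>x\<in>I1. emeasure lborel (T1 (fst x) (snd x)))"
      unfolding U1_def using S1 fin by (intro emeasure_subadditive_finite) auto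
    also have "\<dots> \<le> (\<Sum>x\<in>I1. ennreal (\<delta> * K))" using S1 by (intro sum_mono) auto
    finally have E1: "emeasure lborel U1 \<le> of_nat (card I1) * ennreal (\<delta> * K)" by simp
    have "emeasure lborel U2 \<le> (\<Sum>x\<in>I2. emeasure lborel (T2 (fst x) (snd x)))"
      unfolding U2_def using S2 fin by (intro emeasure_subadditive_finite) auto
    also have "\<dots> \<le> (\<Sum>x\<in>I2. ennreal (\<delta> * K))" using S2 by (intro sum_mono) auto
    finally have E2: "emeasure lborel U2 \<le> of_nat (card I2) * ennreal (\<delta> * K)" by simp
    have "emeasure lborel (U1 \<union> U2) \<le> emeasure lborel U1 + emeasure lborel U2"
      using S1 S2 fin by (intro emeasure_subadditive) (auto simp: U1_def U2_def intro!: sets.finite_UN)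
    also have "\<dots> \<le> of_nat (card I1) * ennreal (\<delta> * K) + of_nat (card I2) * ennreal (\<delta> * K)"
      using E1 E2 by (rule add_mono)
    also have "\<dots> = ennreal ((card I1 + card I2) * (\<delta> * K))"
      using \<delta> K by (simp add: ennreal_of_nat_eq_real_of_nat distrib_right flip: ennreal_mult' ennreal_plus)
    also have "\<dots> < ennreal 1"
    proof (intro ennreal_lessI)
      have "real (card I1 + card I2) \<le> real (12 * (Q * Q))" using card1 card2 by (simp only: of_nat_le_iff)
      then have "(card I1 + card I2) * (\<delta> * K) \<le> 12 * (real Q)\<^sup>2 * (\<delta> * K)"
        using \<delta> K by (intro mult_right_mono) (auto simp: power2_eq_square)
      also have "\<dots> = 12 * (c0 * K)" using Q by (simp add: \<delta>_def)
      also have "\<dots> \<le> 12 * (1 / (13 * K) * K)" using c0 K by (intro mult_left_mono mult_right_mono) auto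
      also have "\<dots> < 1" using K by simp
      finally show "(card I1 + card I2) * (\<delta> * K) < 1" by simp
    qed simp
    finally have less: "emeasure lborel (U1 \<union> U2) < 1" by simp
    have "\<not> {1..2::real} \<subseteq> U1 \<union> U2"
    proof
      assume "{1..2::real} \<subseteq> U1 \<union> U2"
      then have "emeasure lborel {1..2::real} \<le> emeasure lborel (U1 \<union> U2)"
        using S1 S2 fin by (intro emeasure_mono) (auto simp: U1_def U2_def intro!: sets.Un sets.finite_UN)
      then show False using less by simp
    qed
    then obtain s where "s \<in> {1..2}" "s \<notin> U1 \<union> U2" by (meson subsetI)
    then have s: "s \<in> {1..2}" "s \<notin> U1" "s \<notin> U2" by simp_all
    have sep: "\<delta> \<le> \<bar>s * (of_int a + \<rho> * of_int b) + \<mu> * of_int c\<bar> \<and>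
      \<delta> \<le> \<bar>\<rho> * of_int a + of_int b + s * \<nu> * of_int c\<bar>"
      if abc: "\<bar>a\<bar> < int Q" "\<bar>b\<bar> < int Q" "\<bar>c\<bar> < 2 * int Q" "(a, b) \<noteq> (0, 0)" for a b c :: int
    proof
      have "(a, b) \<in> I1" using abc by (auto simp: I1_def)
      then have "s \<notin> T1 a b" using s(2) by (auto simp: U1_def)
      then show "\<delta> \<le> \<bar>s * (of_int a + \<rho> * of_int b) + \<mu> * of_int c\<bar>" using T1[OF abc(4,2)] s(1) by blast
      show "\<delta> \<le> \<bar>\<rho> * of_int a + of_int b + s * \<nu> * of_int c\<bar>"
      \<comment> \<open>Without \<open>c\<close> the form does not involve \<open>s\<close>; the
        Diophantine bound applies with \<open>a\<close> and \<open>b\<close> exchanged.\<close>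
      proof (cases "c = 0")
        case True
        have "1 / (2 * real Q) \<le> \<bar>of_int b + \<rho> * of_int a\<bar>" using abc by (intro dio') auto
        with \<delta>(4) have "\<delta> \<le> \<bar>of_int b + \<rho> * of_int a\<bar>" by (rule order_trans)
        then show ?thesis using True by (simp add: add.commute)
      next
        case False
        then have "(a, c) \<in> I2" using abc by (auto simp: I2_def)
        then have "s \<notin> T2 a c" using s(3) by (auto simp: U2_def)
        then show ?thesis using T2[OF False, of a] s(1) by blast
      qed
    qed
    show ?thesis
      by (intro bexI[OF _ s(1)] allI impI, elim conjE) (rule sep[unfolded \<delta>_def])
  qed
  then show ?thesis
    by (intro exI[of _ c0] conjI c0(1) allI impI) auto
qed

section \<open>Codes with large Hamming distance\<close>

definition hamming :: "nat \<Rightarrow> (nat \<Rightarrow> nat) \<Rightarrow> (nat \<Rightarrow> nat) \<Rightarrow> nat" where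
  "hamming N x y = card {t. t < N \<and> x t \<noteq> y t}"

text \<open>A word in the ball is determined by the set where it differs from \<open>y\<close>, one
  of at most \<open>2 ^ N\<close>, and by its at most \<open>D\<close> values there.\<close>

lemma card_hamming_ball_le:
  assumes "1 \<le> Q"
  shows "card {x \<in> {..<N} \<rightarrow>\<^sub>E {..<Q}. hamming N x y \<le> D} \<le> 2 ^ N * Q ^ D"
proof -
  let ?A = "{A. A \<subseteq> {..<N} \<and> card A \<le> D}"
  let ?ext = "\<lambda>A z. (\<lambda>t\<in>{..<N}. if t \<in> A then z t else y t)"
  have finA: "finite ?A" by (rule finite_subset[of _ "Pow {..<N}"]) auto
  have "{x \<in> {..<N} \<rightarrow>\<^sub>E {..<Q}. hamming N x y \<le> D} \<subseteq> (\<Union>A\<in>?A. ?ext A ` (A \<rightarrow>\<^sub>E {..<Q}))"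
  proof
    fix x assume "x \<in> {x \<in> {..<N} \<rightarrow>\<^sub>E {..<Q}. hamming N x y \<le> D}"
    then have x: "x \<in> {..<N} \<rightarrow>\<^sub>E {..<Q}" "hamming N x y \<le> D" by auto
    define A where "A = {t. t < N \<and> x t \<noteq> y t}"
    have "A \<in> ?A" using x by (auto simp: A_def hamming_def)
    moreover have "restrict x A \<in> A \<rightarrow>\<^sub>E {..<Q}" using x by (auto simp: A_def)
    moreover have "x = ?ext A (restrict x A)"
      using x(1) by (auto simp: A_def fun_eq_iff restrict_def PiE_def extensional_def)
    ultimately show "x \<in> (\<Union>A\<in>?A. ?ext A ` (A \<rightarrow>\<^sub>E {..<Q}))" by blast
  qed
  then have "card {x \<in> {..<N} \<rightarrow>\<^sub>E {..<Q}. hamming N x y \<le> D} \<le> card (\<Union>A\<in>?A. ?ext A ` (A \<rightarrow>\<^sub>E {..<Q}))"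
    using finA by (intro card_mono) (auto intro!: finite_PiE finite_imageI intro: finite_subset)
  also have "\<dots> \<le> (\<Sum>A\<in>?A. card (?ext A ` (A \<rightarrow>\<^sub>E {..<Q})))" by (rule card_UN_le[OF finA])
  also have "\<dots> \<le> (\<Sum>A\<in>?A. Q ^ D)"
  proof (intro sum_mono)
    fix A assume A: "A \<in> ?A"
    then have f: "finite A" by (auto intro: finite_subset)
    have "card (?ext A ` (A \<rightarrow>\<^sub>E {..<Q})) \<le> card (A \<rightarrow>\<^sub>E {..<Q})"
      using f by (intro card_image_le finite_PiE) auto
    also have "\<dots> = Q ^ card A" using f by (simp add: card_PiE)
    also have "\<dots> \<le> Q ^ D" using A assms by (intro power_increasing) auto
    finally show "card (?ext A ` (A \<rightarrow>\<^sub>E {..<Q})) \<le> Q ^ D" .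
  qed
  also have "\<dots> = card ?A * Q ^ D" by simp
  also have "\<dots> \<le> 2 ^ N * Q ^ D"
  proof (intro mult_right_mono)
    have "card ?A \<le> card (Pow {..<N})" by (intro card_mono) auto
    then show "card ?A \<le> 2 ^ N" by (simp add: card_Pow)
  qed simp
  finally show ?thesis .
qed

text \<open>A code of largest size cannot be extended, so the balls of radius \<open>D\<close>
  around its words cover all words.\<close>

lemma gilbert_varshamov:
  assumes Q: "1 \<le> Q"
  shows "\<exists>M (w :: nat \<Rightarrow> nat \<Rightarrow> nat). Q ^ N \<le> M * (2 ^ N * Q ^ D) \<and> (\<forall>m<M. \<forall>t<N. w m t < Q) \<and>
    (\<forall>m<M. \<forall>m'<M. m \<noteq> m' \<longrightarrow> D < hamming N (w m) (w m'))"
proof -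
  let ?X = "{..<N} \<rightarrow>\<^sub>E {..<Q}"
  have finX: "finite ?X" by (intro finite_PiE) auto
  define good where "good S \<longleftrightarrow> S \<subseteq> ?X \<and> (\<forall>x\<in>S. \<forall>y\<in>S. x \<noteq> y \<longrightarrow> D < hamming N x y)" for S
  have "\<exists>S. good S \<and> (\<forall>S'. good S' \<longrightarrow> card S' \<le> card S)"
  proof (rule Lattices_Big.ex_has_greatest_nat)
    show "good {}" by (simp add: good_def)
    show "\<forall>S. good S \<longrightarrow> card S < Suc (card ?X)"
      by (auto simp: good_def less_Suc_eq_le intro: card_mono[OF finX])
  qed
  then obtain S where S: "good S" "\<And>S'. good S' \<Longrightarrow> card S' \<le> card S" by blast
  have finS: "finite S" using S(1) finX by (auto simp: good_def intro: finite_subset)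
  have sym: "hamming N x y = hamming N y x" for x y by (simp add: hamming_def eq_commute)
  have "?X \<subseteq> (\<Union>y\<in>S. {x \<in> ?X. hamming N x y \<le> D})"
  proof
    fix x assume x: "x \<in> ?X"
    show "x \<in> (\<Union>y\<in>S. {x \<in> ?X. hamming N x y \<le> D})"
    proof (rule ccontr)
      assume "\<not> ?thesis"
      then have far: "\<And>y. y \<in> S \<Longrightarrow> D < hamming N x y" using x by (auto simp: not_le)
      moreover have "hamming N x x = 0" by (simp add: hamming_def)
      ultimately have "x \<notin> S" by fastforce
      moreover have "good (insert x S)" using S(1) x far sym by (auto simp: good_def)
      ultimately show False using S(2)[of "insert x S"] finS by simp
    qed
  qed
  then have "card ?X \<le> card (\<Union>y\<in>S. {x \<in> ?X. hamming N x y \<le> D})"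
    using finS finX by (intro card_mono) auto
  also have "\<dots> \<le> (\<Sum>y\<in>S. card {x \<in> ?X. hamming N x y \<le> D})" by (rule card_UN_le[OF finS])
  also have "\<dots> \<le> (\<Sum>y\<in>S. 2 ^ N * Q ^ D)" by (intro sum_mono card_hamming_ball_le Q)
  finally have card: "Q ^ N \<le> card S * (2 ^ N * Q ^ D)" by (simp add: card_PiE)
  obtain w where w: "bij_betw w {..<card S} S"
    using ex_bij_betw_nat_finite[OF finS] by (auto simp: atLeast0LessThan)
  have wS: "w m \<in> S" if "m < card S" for m using w that by (auto simp: bij_betw_def)
  have "w m \<noteq> w m'" if "m < card S" "m' < card S" "m \<noteq> m'" for m m'
    using w that by (auto simp: bij_betw_def inj_on_def)
  then have "\<forall>m<card S. \<forall>m'<card S. m \<noteq> m' \<longrightarrow> D < hamming N (w m) (w m')"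
    using S(1) wS by (auto simp: good_def)
  moreover have "\<forall>m<card S. \<forall>t<N. w m t < Q" using S(1) wS by (fastforce simp: good_def)
  ultimately show ?thesis using card by blast
qed

section \<open>Decoding and achievability\<close>

text \<open>The count is rewritten as a finite sum of indicators, which is measurable.\<close>

lemma pred_card_exceed:
  fixes N D :: nat
  assumes [measurable]: "\<And>t. t < N \<Longrightarrow> Measurable.pred M (P t)"
  shows "Measurable.pred M (\<lambda>y. card {t. t < N \<and> P t y} \<le> D)"
proof -
  have "card {t. t < N \<and> P t y} \<le> D \<longleftrightarrow> (\<Sum>t<N. if P t y then 1 else 0 :: real) \<le> real D" for y
  proof -
    have "{t. t < N \<and> P t y} = {..<N} \<inter> {t. P t y}" by auto
    then have "real (card {t. t < N \<and> P t y}) = (\<Sum>t\<in>{..<N} \<inter> {t. P t y}. 1)" by simp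
    also have "\<dots> = (\<Sum>t<N. if P t y then 1 else 0)" by (subst sum.inter_restrict) auto
    finally show ?thesis by (metis of_nat_le_iff)
  qed
  moreover have "(\<lambda>y. \<Sum>t<N. if P t y then 1 else 0 :: real) \<in> borel_measurable M"
    by (intro borel_measurable_sum measurable_If) auto
  ultimately show ?thesis by simp
qed

text \<open>Bounded distance decoding: a message is compatible with \<open>y\<close> if
  \<open>y\<close> is off by at least \<open>d / 2\<close> at no more than \<open>D\<close> times.
  By the triangle inequality, two compatible messages are at least \<open>d\<close> apart at no more
  than \<open>2 * D\<close> times, so \<open>sep\<close> makes their estimates agree. The true
  message is compatible unless the noise is large too often.\<close>

lemma separated_code_decoder:
  assumes pw: "\<forall>W\<in>messages N R. \<forall>j. (\<Sum>t<N. (enc j (W 1 j, W 2 j) t)\<^sup>2) \<le> real N * P"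
    and sep: "\<And>W W' i. W \<in> messages N R \<Longrightarrow> W' \<in> messages N R \<Longrightarrow> (W i 1, W i 2) \<noteq> (W' i 1, W' i 2) \<Longrightarrow>
      2 * D < card {t. t < N \<and> d \<le> \<bar>noiseless h enc W i t - noiseless h enc W' i t\<bar>}"
  shows "\<exists>dec. X_code N P R enc dec \<and> (\<forall>W\<in>messages N R. \<forall>i. rx_error h N enc dec i W \<le>
    measure (gauss {..<N}) {z \<in> space (gauss {..<N}). \<not> card {t. t < N \<and> d / 2 \<le> \<bar>z t\<bar>} \<le> D})"
proof -
  let ?M = "messages N R" and ?S = "PiM {..<N} (\<lambda>_. borel) :: (nat \<Rightarrow> real) measure"
  define compat where "compat i y W \<longleftrightarrow> card {t. t < N \<and> d / 2 \<le> \<bar>y t - noiseless h enc W i t\<bar>} \<le> D" for i y W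
  \<comment> \<open>Compatible tuples may differ in the messages for the other receiver, but
    \<open>unique\<close> makes the returned pair independent of the choice. The default
    \<open>(0, 0)\<close> arises only if no tuple is compatible.\<close>
  define dec where "dec i y = (if \<exists>W\<in>?M. compat i y W
      then let W = (SOME W. W \<in> ?M \<and> compat i y W) in (W i 1, W i 2) else (0, 0))" for i y
  have unique: "(W i 1, W i 2) = (W' i 1, W' i 2)"
    if W: "W \<in> ?M" "W' \<in> ?M" "compat i y W" "compat i y W'" for W W' i y
  proof (rule ccontr)
    assume ne: "(W i 1, W i 2) \<noteq> (W' i 1, W' i 2)"
    let ?B = "\<lambda>W. {t. t < N \<and> d / 2 \<le> \<bar>y t - noiseless h enc W i t\<bar>}"
    have "{t. t < N \<and> d \<le> \<bar>noiseless h enc W i t - noiseless h enc W' i t\<bar>} \<subseteq> ?B W \<union> ?B W'"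
      by (auto simp: abs_if split: if_splits)
    then have "card {t. t < N \<and> d \<le> \<bar>noiseless h enc W i t - noiseless h enc W' i t\<bar>} \<le> card (?B W \<union> ?B W')"
      by (intro card_mono) auto
    also have "\<dots> \<le> card (?B W) + card (?B W')" by (rule card_Un_le)
    also have "\<dots> \<le> 2 * D" using W(3,4) by (simp add: compat_def)
    finally show False using sep[OF W(1,2) ne] by simp
  qed
  have dec_eq: "dec i y = (W i 1, W i 2)" if "W \<in> ?M" "compat i y W" for W i y
  proof -
    have "\<exists>W. W \<in> ?M \<and> compat i y W" using that by blast
    then have "(SOME W. W \<in> ?M \<and> compat i y W) \<in> ?M \<and> compat i y (SOME W. W \<in> ?M \<and> compat i y W)"
      by (rule someI_ex)
    then show ?thesis using unique that unfolding dec_def Let_def by (auto simp: Bex_def)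
  qed
  have [measurable]: "Measurable.pred ?S (\<lambda>y. compat i y W)" for i W
    unfolding compat_def by (intro pred_card_exceed) measurable
  have fin: "finite ?M" by (rule messages_finite_nonempty)
  have meas: "dec i \<in> ?S \<rightarrow>\<^sub>M count_space UNIV" for i
  proof (subst measurable_count_space_eq_countable)
    show "dec i \<in> space ?S \<rightarrow> UNIV \<and> (\<forall>w\<in>UNIV. dec i -` {w} \<inter> space ?S \<in> sets ?S)"
    proof safe
      fix w1 w2 :: nat
      \<comment> \<open>A finite Boolean combination of the compatibility events that describes the
        preimage without the choice operator, hence visibly measurable.\<close>
      define Q where "Q y \<longleftrightarrow> (\<exists>W\<in>{W\<in>?M. (W i 1, W i 2) = (w1, w2)}. compat i y W) \<or>
          (w1, w2) = (0, 0) \<and> \<not> (\<exists>W\<in>?M. compat i y W)" for y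
      have "dec i y = (w1, w2) \<longleftrightarrow> Q y" for y
      proof (cases "\<exists>W\<in>?M. compat i y W")
        case True
        then obtain W where W: "W \<in> ?M" "compat i y W" by blast
        show ?thesis
        proof
          assume "dec i y = (w1, w2)"
          then have "(W i 1, W i 2) = (w1, w2)" using dec_eq[OF W] by simp
          then show "Q y" using W unfolding Q_def by blast
        next
          assume "Q y"
          then obtain W' where W': "W' \<in> ?M" "compat i y W'" "(W' i 1, W' i 2) = (w1, w2)" using True unfolding Q_def by blast
          show "dec i y = (w1, w2)" using dec_eq[OF W'(1,2)] W'(3) by (rule trans)
        qed
      qed (auto simp: dec_def Q_def)
      then have eq: "dec i -` {(w1, w2)} \<inter> space ?S = {y \<in> space ?S. Q y}" by auto
      have [simp]: "finite {W\<in>?M. (W i 1, W i 2) = (w1, w2)}" using fin by simp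
      show "dec i -` {(w1, w2)} \<inter> space ?S \<in> sets ?S"
        unfolding eq Q_def using fin by measurable
    qed auto
  qed auto
  have "X_code N P R enc dec" using pw meas by (simp add: X_code_def)
  moreover have "rx_error h N enc dec i W \<le>
    measure (gauss {..<N}) {z \<in> space (gauss {..<N}). \<not> card {t. t < N \<and> d / 2 \<le> \<bar>z t\<bar>} \<le> D}"
    if W: "W \<in> ?M" for W i
  proof -
    interpret G: prob_space "gauss {..<N}" by (rule prob_space_gauss)
    have [measurable]: "Measurable.pred (gauss {..<N}) (\<lambda>z. card {t. t < N \<and> d / 2 \<le> \<bar>z t\<bar>} \<le> D)"
      by (intro pred_card_exceed) measurable
    show ?thesis unfolding rx_error_def
    proof (intro G.finite_measure_mono)
      have "compat i (\<lambda>t\<in>{..<N}. noiseless h enc W i t + z t) W" if "card {t. t < N \<and> d / 2 \<le> \<bar>z t\<bar>} \<le> D" for z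
        using that by (simp add: compat_def cong: conj_cong)
      then show "{z \<in> space (gauss {..<N}). dec i (\<lambda>t\<in>{..<N}. noiseless h enc W i t + z t) \<noteq> (W i 1, W i 2)} \<subseteq>
          {z \<in> space (gauss {..<N}). \<not> card {t. t < N \<and> d / 2 \<le> \<bar>z t\<bar>} \<le> D}"
        using dec_eq[OF W] by blast
    qed measurable
  qed
  ultimately show ?thesis by blast
qed

section \<open>Few large noise samples\<close>

lemma gauss_tail_small:
  assumes "0 < e"
  shows "\<exists>\<theta>>0. measure std_gauss {x. \<theta> \<le> \<bar>x\<bar>} \<le> e"
proof -
  interpret M: prob_space std_gauss by (rule prob_space_std_gauss)
  have "(\<lambda>n. measure std_gauss {x. real n \<le> \<bar>x\<bar>}) \<longlonglongrightarrow> measure std_gauss (\<Inter>n. {x. real n \<le> \<bar>x\<bar>})"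
    by (intro M.finite_Lim_measure_decseq) (auto simp: decseq_def)
  moreover have "(\<Inter>n. {x::real. real n \<le> \<bar>x\<bar>}) = {}"
  proof -
    have "\<exists>n. \<not> real n \<le> \<bar>x\<bar>" for x :: real
      using reals_Archimedean2[of "\<bar>x\<bar>"] by (simp add: not_le)
    then show ?thesis by blast
  qed
  ultimately have "(\<lambda>n. measure std_gauss {x. real n \<le> \<bar>x\<bar>}) \<longlonglongrightarrow> 0" by simp
  then have "eventually (\<lambda>n. measure std_gauss {x. real n \<le> \<bar>x\<bar>} < e) sequentially"
    using assms by (rule order_tendstoD)
  then have "eventually (\<lambda>n. measure std_gauss {x. real n \<le> \<bar>x\<bar>} < e \<and> 0 < n) sequentially"
    using eventually_gt_at_top[of 0] by (rule eventually_conj)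
  then obtain n :: nat where "measure std_gauss {x. real n \<le> \<bar>x\<bar>} < e \<and> 0 < n"
    using eventually_happens' sequentially_bot by blast
  then show ?thesis by (intro exI[of _ "real n"]) auto
qed

text \<open>Exponential Markov inequality: weight each exceedance by \<open>4 powr (1 / \<tau>)\<close>.\<close>

lemma few_exceedances:
  assumes \<tau>: "0 < \<tau>"
  shows "\<exists>\<theta>>0. \<forall>N. measure (gauss {..<N}) {z \<in> space (gauss {..<N}). \<not> card {t. t < N \<and> \<theta> \<le> \<bar>z t\<bar>} \<le> nat \<lfloor>\<tau> * real N\<rfloor>} \<le> (1 / 2) ^ N"
proof -
  \<comment> \<open>With this weight, \<open>\<tau> * N\<close> exceedances contribute at least
    \<open>4 ^ N\<close>, while \<open>\<theta>\<close> is chosen so that the mean weight per sample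
    is at most 2. The ratio is \<open>(1 / 2) ^ N\<close>.\<close>
  define B where "B = 4 powr (1 / \<tau>)"
  have B: "1 \<le> B" using \<tau> by (simp add: B_def ge_one_powr_ge_zero)
  obtain \<theta> where \<theta>: "0 < \<theta>" "measure std_gauss {x. \<theta> \<le> \<bar>x\<bar>} \<le> 1 / B"
    using gauss_tail_small[of "1 / B"] B by auto
  interpret M: prob_space std_gauss by (rule prob_space_std_gauss)
  interpret product_sigma_finite "\<lambda>_. std_gauss" by (rule product_sigma_finite_std_gauss)
  define g where "g x = (if \<theta> \<le> \<bar>x\<bar> then ennreal B else 1)" for x :: real
  have [measurable]: "g \<in> borel_measurable borel" unfolding g_def by measurable
  have "(\<integral>\<^sup>+ x. g x \<partial>std_gauss) \<le> (\<integral>\<^sup>+ x. 1 + ennreal B * indicator {x. \<theta> \<le> \<bar>x\<bar>} x \<partial>std_gauss)"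
    by (intro nn_integral_mono) (auto simp: g_def indicator_def)
  also have "\<dots> = 1 + ennreal B * ennreal (measure std_gauss {x. \<theta> \<le> \<bar>x\<bar>})"
    using M.emeasure_space_1 by (simp add: nn_integral_add nn_integral_cmult M.emeasure_eq_measure)
  also have "\<dots> \<le> 1 + ennreal B * ennreal (1 / B)"
    using \<theta> by (intro add_left_mono mult_left_mono ennreal_leI) auto
  also have "\<dots> = 2" using B by (simp flip: ennreal_mult')
  finally have g2: "(\<integral>\<^sup>+ x. g x \<partial>std_gauss) \<le> 2" .
  have "measure (gauss {..<N}) {z \<in> space (gauss {..<N}). \<not> card {t. t < N \<and> \<theta> \<le> \<bar>z t\<bar>} \<le> nat \<lfloor>\<tau> * real N\<rfloor>} \<le> (1 / 2) ^ N" for N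
  proof -
    interpret G: prob_space "gauss {..<N}" by (rule prob_space_gauss)
    let ?E = "{z \<in> space (gauss {..<N}). \<not> card {t. t < N \<and> \<theta> \<le> \<bar>z t\<bar>} \<le> nat \<lfloor>\<tau> * real N\<rfloor>}"
    have [measurable]: "Measurable.pred (gauss {..<N}) (\<lambda>z. card {t. t < N \<and> \<theta> \<le> \<bar>z t\<bar>} \<le> nat \<lfloor>\<tau> * real N\<rfloor>)"
      by (intro pred_card_exceed) measurable
    have ptw: "ennreal (4 ^ N) * indicator ?E z \<le> (\<Prod>t<N. g (z t))" for z
    proof (cases "z \<in> ?E")
      case True
      define T where "T = {t. t < N \<and> \<theta> \<le> \<bar>z t\<bar>}"
      have T: "\<tau> * real N \<le> real (card T)" using True by (auto simp: T_def) linarith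
      have "(\<Prod>t<N. g (z t)) = (\<Prod>t\<in>T. ennreal B)"
        by (intro prod.mono_neutral_cong_right) (auto simp: T_def g_def)
      also have "\<dots> = ennreal (B ^ card T)" using B by (simp add: ennreal_power)
      finally have "(\<Prod>t<N. g (z t)) = ennreal (B ^ card T)" .
      moreover have "4 ^ N \<le> B ^ card T"
      proof -
        have "B powr (\<tau> * real N) = 4 powr (real N)" using \<tau> by (simp add: B_def powr_powr)
        also have "\<dots> = 4 ^ N" by (simp add: powr_realpow)
        finally have "4 ^ N = B powr (\<tau> * real N)" ..
        also have "\<dots> \<le> B powr (real (card T))" using T B by (intro powr_mono) auto
        also have "\<dots> = B ^ card T" using B by (simp add: powr_realpow)
        finally show ?thesis .
      qed
      ultimately show ?thesis using True by (simp add: ennreal_leI)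
    qed simp
    have "ennreal (4 ^ N) * emeasure (gauss {..<N}) ?E = (\<integral>\<^sup>+ z. ennreal (4 ^ N) * indicator ?E z \<partial>gauss {..<N})"
      by (subst nn_integral_cmult_indicator) auto
    also have "\<dots> \<le> (\<integral>\<^sup>+ z. (\<Prod>t<N. g (z t)) \<partial>gauss {..<N})" by (intro nn_integral_mono ptw)
    also have "\<dots> = (\<Prod>t<N. \<integral>\<^sup>+ x. g x \<partial>std_gauss)" by (intro product_nn_integral_prod) auto
    also have "\<dots> \<le> (\<Prod>t<N. 2)" using g2 by (intro prod_mono_ennreal)
    also have "\<dots> = ennreal (2 ^ N)" by (simp add: ennreal_power[symmetric])
    finally have "ennreal (4 ^ N * measure (gauss {..<N}) ?E) \<le> ennreal (2 ^ N)"
      by (simp add: G.emeasure_eq_measure ennreal_mult')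
    then have "4 ^ N * measure (gauss {..<N}) ?E \<le> 2 ^ N" by (simp add: ennreal_le_iff)
    moreover have "(4::real) ^ N = 2 ^ N * 2 ^ N" by (simp flip: power_mult_distrib)
    ultimately show ?thesis by (simp add: power_divide field_simps)
  qed
  then show ?thesis using \<theta>(1) by blast
qed


section \<open>The alignment scheme and its rate\<close>

lemma num_messages_le:
  assumes "2 powr (real N * r) \<le> real M" shows "num_messages N r \<le> M"
  using assms unfolding num_messages_def by (simp add: ceiling_le_iff nat_le_iff)

text \<open>The Hamming distance costs the share \<open>2 * \<tau>\<close> of
  \<open>log 2 Q\<close>; the factor \<open>2 ^ N\<close> in the ball size costs one further bit per
  symbol.\<close>

lemma outer_code_size:
  assumes Q: "1 \<le> Q" and \<tau>: "0 \<le> \<tau>" and r: "r = (1 - 2 * \<tau>) * log 2 (real Q) - 1"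
    and M: "Q ^ N \<le> M * (2 ^ N * Q ^ (2 * nat \<lfloor>\<tau> * real N\<rfloor>))"
  shows "num_messages N r \<le> M"
proof (rule num_messages_le)
  let ?D = "nat \<lfloor>\<tau> * real N\<rfloor>"
  have Q0: "0 < real Q" using Q by simp
  have "2 powr (real N * r) = (2 powr log 2 (real Q)) powr (real N - 2 * (\<tau> * real N)) * 2 powr (- real N)"
    by (simp add: r powr_powr flip: powr_add) (simp add: algebra_simps)
  also have "\<dots> = real Q powr (real N - 2 * (\<tau> * real N)) * 2 powr (- real N)"
    using Q0 by simp
  also have "\<dots> \<le> real Q powr (real N - real (2 * ?D)) * 2 powr (- real N)"
    using Q \<tau> by (intro mult_right_mono powr_mono) (auto simp: of_nat_nat)
  also have "\<dots> = real Q ^ N / (2 ^ N * real Q ^ (2 * ?D))"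
    using Q0 by (simp add: powr_diff powr_minus powr_realpow[symmetric] divide_inverse ac_simps)
  also have "\<dots> \<le> real M"
  proof -
    have "real (Q ^ N) \<le> real (M * (2 ^ N * Q ^ (2 * ?D)))" using M by (simp only: of_nat_le_iff)
    then have "real Q ^ N \<le> real M * (2 ^ N * real Q ^ (2 * ?D))" by simp
    then show ?thesis using Q0 by (subst pos_divide_le_eq) auto
  qed
  finally show "2 powr (real N * r) \<le> real M" .
qed

text \<open>With \<open>u1, u2\<close> intended for receiver 1 and \<open>v1, v2\<close> for receiver 2, the symbols \<open>v1\<close> and \<open>v2\<close> arrive
  at receiver 1 with the same coefficient \<open>h11 h12\<close>, and \<open>u1\<close> and \<open>u2\<close> at receiver 2 with the same
  coefficient \<open>s h21 h22\<close>.\<close>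

definition align_enc :: "real^2^2 \<Rightarrow> real \<Rightarrow> real \<Rightarrow> (nat \<Rightarrow> nat \<Rightarrow> nat) \<Rightarrow> encoders" where
  "align_enc h A s w j m t = A * (if j = 1
     then s * h $ 2 $ 2 * real (w (fst m) t) + h $ 1 $ 2 * real (w (snd m) t)
     else s * h $ 2 $ 1 * real (w (fst m) t) + h $ 1 $ 1 * real (w (snd m) t))"

text \<open>With \<open>h $ 1 $ 1 * h $ 2 $ 2\<close> factored out, these are the two linear forms
  of \<open>separating_scale\<close>, for \<open>\<mu> = h12 / h22\<close> and
  \<open>\<nu> = h21 / h11\<close>.\<close>

lemma noiseless_align_enc:
  fixes h :: "real^2^2"
  assumes h: "\<And>i j. 0 < h $ i $ j" and \<rho>: "\<rho> = h $ 1 $ 2 * h $ 2 $ 1 / (h $ 1 $ 1 * h $ 2 $ 2)"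
  shows "noiseless h (align_enc h A s w) W 1 t = A * (h $ 1 $ 1 * h $ 2 $ 2) *
      (s * (real (w (W 1 1) t) + \<rho> * real (w (W 1 2) t)) + h $ 1 $ 2 / h $ 2 $ 2 * (real (w (W 2 1) t) + real (w (W 2 2) t)))"
    and "noiseless h (align_enc h A s w) W 2 t = A * (h $ 1 $ 1 * h $ 2 $ 2) *
      (\<rho> * real (w (W 2 1) t) + real (w (W 2 2) t) + s * (h $ 2 $ 1 / h $ 1 $ 1) * (real (w (W 1 1) t) + real (w (W 1 2) t)))"
proof -
  have ne: "h $ 1 $ 1 \<noteq> 0" "h $ 2 $ 2 \<noteq> 0" using h[of 1 1] h[of 2 2] by auto
  show "noiseless h (align_enc h A s w) W 1 t = A * (h $ 1 $ 1 * h $ 2 $ 2) *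
      (s * (real (w (W 1 1) t) + \<rho> * real (w (W 1 2) t)) + h $ 1 $ 2 / h $ 2 $ 2 * (real (w (W 2 1) t) + real (w (W 2 2) t)))"
    using ne by (simp add: noiseless_def align_enc_def sum_2 \<rho> field_simps)
  show "noiseless h (align_enc h A s w) W 2 t = A * (h $ 1 $ 1 * h $ 2 $ 2) *
      (\<rho> * real (w (W 2 1) t) + real (w (W 2 2) t) + s * (h $ 2 $ 1 / h $ 1 $ 1) * (real (w (W 1 1) t) + real (w (W 1 2) t)))"
    using ne by (simp add: noiseless_def align_enc_def sum_2 \<rho> field_simps)
qed

text \<open>The threshold \<open>\<theta>\<close> depends only on \<open>\<tau>\<close>, and
  \<open>c0\<close> only on the channel, so the power constant \<open>K\<close> is fixed before
  \<open>Q\<close>. This is what gives \<open>1/2 log P\<close> the growth \<open>3 log Q\<close>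
  along the good \<open>Q\<close>.\<close>

lemma achievable_alignment:
  fixes h :: "real^2^2"
  assumes h: "\<And>i j. 0 < h $ i $ j" and irr: "h $ 1 $ 2 * h $ 2 $ 1 / (h $ 1 $ 1 * h $ 2 $ 2) \<notin> \<rat>"
    and \<tau>: "0 < \<tau>"
  shows "\<exists>K>0. \<forall>Q0. \<exists>Q\<ge>Q0. 0 \<le> (1 - 2 * \<tau>) * log 2 (real Q) - 1 \<longrightarrow>
    achievable h (K * real Q ^ 6) (\<lambda>_ _. (1 - 2 * \<tau>) * log 2 (real Q) - 1)"
proof -
  define \<rho> where "\<rho> = h $ 1 $ 2 * h $ 2 $ 1 / (h $ 1 $ 1 * h $ 2 $ 2)"
  define \<mu> where "\<mu> = h $ 1 $ 2 / h $ 2 $ 2"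
  define \<nu> where "\<nu> = h $ 2 $ 1 / h $ 1 $ 1"
  have \<mu>\<nu>: "0 < \<mu>" "0 < \<nu>" using h by (auto simp: \<mu>_def \<nu>_def)
  obtain \<theta> where \<theta>: "0 < \<theta>" and tail: "\<And>N. measure (gauss {..<N}) {z \<in> space (gauss {..<N}).
      \<not> card {t. t < N \<and> \<theta> \<le> \<bar>z t\<bar>} \<le> nat \<lfloor>\<tau> * real N\<rfloor>} \<le> (1 / 2) ^ N"
    using few_exceedances[OF \<tau>] by blast
  obtain c0 where c0: "0 < c0" and scale: "\<And>Q::nat. 1 \<le> Q \<Longrightarrow>
    (\<forall>a b :: int. b \<noteq> 0 \<and> \<bar>b\<bar> < int Q \<longrightarrow> 1 / (2 * real Q) \<le> \<bar>of_int a + \<rho> * of_int b\<bar>) \<Longrightarrow>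
    (\<exists>s\<in>{1..2}. \<forall>a b c :: int. \<bar>a\<bar> < int Q \<and> \<bar>b\<bar> < int Q \<and> \<bar>c\<bar> < 2 * int Q \<and> (a, b) \<noteq> (0, 0) \<longrightarrow>
      c0 / (real Q)\<^sup>2 \<le> \<bar>s * (of_int a + \<rho> * of_int b) + \<mu> * of_int c\<bar> \<and>
      c0 / (real Q)\<^sup>2 \<le> \<bar>\<rho> * of_int a + of_int b + s * \<nu> * of_int c\<bar>)"
    using separating_scale[OF \<mu>\<nu>, of \<rho>] by blast
  define G where "G = h $ 1 $ 1 * h $ 2 $ 2"
  have G: "0 < G" using h by (simp add: G_def)
  \<comment> \<open>Chosen so that the separation \<open>c0 / Q^2\<close> becomes exactly
    \<open>2 * \<theta>\<close> after amplification.\<close>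
  define A0 where "A0 = 2 * \<theta> / (G * c0)"
  have A0: "0 < A0" using \<theta> G c0 by (simp add: A0_def)
  \<comment> \<open>The factor 2 accounts for \<open>s \<le> 2\<close>; \<open>H * Q\<close> bounds
    every symbol before amplification.\<close>
  define H where "H = 2 * (h $ 1 $ 1 + h $ 1 $ 2 + h $ 2 $ 1 + h $ 2 $ 2)"
  have H: "0 < H" using h by (simp add: H_def add_pos_pos)
  define K where "K = (A0 * H)\<^sup>2"
  have "\<exists>Q\<ge>Q0. 0 \<le> (1 - 2 * \<tau>) * log 2 (real Q) - 1 \<longrightarrow>
      achievable h (K * real Q ^ 6) (\<lambda>_ _. (1 - 2 * \<tau>) * log 2 (real Q) - 1)" for Q0
  proof -
    obtain Q where Q: "max 1 Q0 \<le> Q"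
      and dio: "\<forall>a b :: int. b \<noteq> 0 \<and> \<bar>b\<bar> < int Q \<longrightarrow> 1 / (2 * real Q) \<le> \<bar>real_of_int a + \<rho> * real_of_int b\<bar>"
      using irrational_good_denominators[OF irr, of "max 1 Q0"] unfolding \<rho>_def by blast
    have Q1: "1 \<le> Q" using Q by simp
    obtain s where s: "s \<in> {1..2}" and sep: "\<And>a b c :: int. \<bar>a\<bar> < int Q \<Longrightarrow> \<bar>b\<bar> < int Q \<Longrightarrow> \<bar>c\<bar> < 2 * int Q \<Longrightarrow> (a, b) \<noteq> (0, 0) \<Longrightarrow>
      c0 / (real Q)\<^sup>2 \<le> \<bar>s * (of_int a + \<rho> * of_int b) + \<mu> * of_int c\<bar> \<and>
      c0 / (real Q)\<^sup>2 \<le> \<bar>\<rho> * of_int a + of_int b + s * \<nu> * of_int c\<bar>"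
      using scale[OF Q1 dio] by blast
    define r where "r = (1 - 2 * \<tau>) * log 2 (real Q) - 1"
    define A where "A = A0 * (real Q)\<^sup>2"
    have A: "0 < A" using A0 Q1 by (simp add: A_def)
    have AG: "2 * \<theta> \<le> A * G * x" if "c0 / (real Q)\<^sup>2 \<le> x" for x
    proof -
      have "2 * \<theta> = A * G * (c0 / (real Q)\<^sup>2)" using G c0 Q1 by (simp add: A_def A0_def)
      also have "\<dots> \<le> A * G * x" using that A G by (intro mult_left_mono) auto
      finally show ?thesis .
    qed
    have code: "\<exists>enc dec. X_code N (K * real Q ^ 6) (\<lambda>_ _. r) enc dec \<and> error_prob h N (\<lambda>_ _. r) enc dec \<le> 2 * (1 / 2) ^ N" for N
    proof -
      \<comment> \<open>The decoder tolerates \<open>?D\<close> large noise samples, so the outer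
        code is taken with distance above \<open>2 * ?D\<close>.\<close>
      let ?D = "nat \<lfloor>\<tau> * real N\<rfloor>"
      obtain M and w :: "nat \<Rightarrow> nat \<Rightarrow> nat" where gv: "Q ^ N \<le> M * (2 ^ N * Q ^ (2 * ?D)) \<and> (\<forall>m<M. \<forall>t<N. w m t < Q) \<and>
          (\<forall>m<M. \<forall>m'<M. m \<noteq> m' \<longrightarrow> 2 * ?D < hamming N (w m) (w m'))"
        using gilbert_varshamov[OF Q1, of N "2 * ?D"] by (elim exE)
      note M = conjunct1[OF gv]
      have wQ: "w m t < Q" if "m < M" "t < N" for m t
        using conjunct1[OF conjunct2[OF gv]] that by simp
      have wd: "2 * ?D < hamming N (w m) (w m')" if "m < M" "m' < M" "m \<noteq> m'" for m m'
        using conjunct2[OF conjunct2[OF gv]] that by simp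
      have msg: "W i j < M" if "W \<in> messages N (\<lambda>_ _. r)" for W i j
      proof -
        have "W i j < num_messages N r" using that by (simp add: messages_def)
        also have "\<dots> \<le> M" using \<tau> by (intro outer_code_size[OF Q1 _ r_def M]) simp
        finally show ?thesis .
      qed
      define enc where "enc = align_enc h A s w"
      have pw: "(\<Sum>t<N. (enc j (W 1 j, W 2 j) t)\<^sup>2) \<le> real N * (K * real Q ^ 6)"
        if W: "W \<in> messages N (\<lambda>_ _. r)" for W j
      proof -
        have "(enc j (W 1 j, W 2 j) t)\<^sup>2 \<le> K * real Q ^ 6" if t: "t < N" for t
        proof -
          have w: "real (w (W i j) t) \<le> real Q" for i using wQ[OF msg[OF W] t, of i j] by simp
          have lin: "s * p * real (w (W 1 j) t) + q * real (w (W 2 j) t) \<le> (2 * p + q) * real Q"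
            if "0 < p" "0 < q" for p q :: real
          proof -
            have "s * p * real (w (W 1 j) t) + q * real (w (W 2 j) t) \<le> 2 * p * real Q + q * real Q"
              using s w that by (intro add_mono mult_mono) auto
            then show ?thesis by (simp add: algebra_simps)
          qed
          have HQ: "x * real Q \<le> H * real Q" if "x \<le> H" for x using that by (intro mult_right_mono) auto
          have "\<bar>enc j (W 1 j, W 2 j) t\<bar> \<le> A * (H * real Q)"
          proof (cases "j = 1")
            case True
            have "s * h $ 2 $ 2 * real (w (W 1 j) t) + h $ 1 $ 2 * real (w (W 2 j) t) \<le> H * real Q"
              using h[of 1 1] h[of 2 1] h[of 1 2] h[of 2 2]
              by (intro order_trans[OF lin HQ]) (auto simp: H_def)
            moreover have "0 \<le> s * h $ 2 $ 2 * real (w (W 1 j) t) + h $ 1 $ 2 * real (w (W 2 j) t)"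
              using s h[of 2 2] h[of 1 2] by (intro add_nonneg_nonneg mult_nonneg_nonneg) auto
            ultimately show ?thesis using True A by (simp add: enc_def align_enc_def abs_mult)
          next
            case False
            have "s * h $ 2 $ 1 * real (w (W 1 j) t) + h $ 1 $ 1 * real (w (W 2 j) t) \<le> H * real Q"
              using h[of 1 1] h[of 2 1] h[of 1 2] h[of 2 2]
              by (intro order_trans[OF lin HQ]) (auto simp: H_def)
            moreover have "0 \<le> s * h $ 2 $ 1 * real (w (W 1 j) t) + h $ 1 $ 1 * real (w (W 2 j) t)"
              using s h[of 2 1] h[of 1 1] by (intro add_nonneg_nonneg mult_nonneg_nonneg) auto
            ultimately show ?thesis using False A by (simp add: enc_def align_enc_def abs_mult)
          qed
          then have "(enc j (W 1 j, W 2 j) t)\<^sup>2 \<le> (A * (H * real Q))\<^sup>2"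
            using A H by (intro abs_le_square_iff[THEN iffD1]) simp
          also have "\<dots> = K * real Q ^ 6"
            by (simp add: K_def A_def power_mult_distrib flip: power_mult power_add)
          finally show ?thesis .
        qed
        then have "(\<Sum>t<N. (enc j (W 1 j, W 2 j) t)\<^sup>2) \<le> (\<Sum>t<N. K * real Q ^ 6)" by (intro sum_mono) auto
        then show ?thesis by simp
      qed
      have far: "2 * ?D < card {t. t < N \<and> 2 * \<theta> \<le> \<bar>noiseless h enc W i t - noiseless h enc W' i t\<bar>}"
        if W: "W \<in> messages N (\<lambda>_ _. r)" "W' \<in> messages N (\<lambda>_ _. r)" and ne: "(W i 1, W i 2) \<noteq> (W' i 1, W' i 2)" for W W' i
      proof -
        obtain j where j: "W i j \<noteq> W' i j" using ne by auto
        have "2 * \<theta> \<le> \<bar>noiseless h enc W i t - noiseless h enc W' i t\<bar>"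
          if t: "t < N" "w (W i j) t \<noteq> w (W' i j) t" for t
        proof -
          define x where "x k l = int (w (W k l) t) - int (w (W' k l) t)" for k l
          have xQ: "\<bar>x k l\<bar> < int Q" for k l
            using wQ[OF msg[OF W(1)] t(1), of k l] wQ[OF msg[OF W(2)] t(1), of k l] by (simp add: x_def)
          \<comment> \<open>Aligned interference is seen only through its sum, whence the range
            \<open>2 * Q\<close> for the third integer.\<close>
          have xx: "\<bar>x k 1 + x k 2\<bar> < 2 * int Q" for k using xQ[of k 1] xQ[of k 2] by linarith
          \<comment> \<open>One differing desired symbol is enough for the separation at time
            \<open>t\<close>, whatever the other three symbols are.\<close>
          have nz: "(x i 1, x i 2) \<noteq> (0, 0)" using t(2) exhaust_2[of j] by (auto simp: x_def)
          have d1: "noiseless h enc W 1 t - noiseless h enc W' 1 t =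
              A * G * (s * (of_int (x 1 1) + \<rho> * of_int (x 1 2)) + \<mu> * of_int (x 2 1 + x 2 2))"
            unfolding enc_def noiseless_align_enc[OF h \<rho>_def] G_def[symmetric] \<mu>_def x_def
            by (simp add: algebra_simps)
          have d2: "noiseless h enc W 2 t - noiseless h enc W' 2 t =
              A * G * (\<rho> * of_int (x 2 1) + of_int (x 2 2) + s * \<nu> * of_int (x 1 1 + x 1 2))"
            unfolding enc_def noiseless_align_enc[OF h \<rho>_def] G_def[symmetric] \<nu>_def x_def
            by (simp add: algebra_simps)
          have AG': "\<bar>A * G * y\<bar> = A * G * \<bar>y\<bar>" for y using A G by (simp add: abs_mult)
          consider "i = 1" | "i = 2" using exhaust_2 by blast
          then show ?thesis
          proof cases
            case 1
            show ?thesis unfolding 1 d1 AG'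
              using sep[OF xQ xQ xx nz[unfolded 1]] by (intro AG) blast
          next
            case 2
            show ?thesis unfolding 2 d2 AG'
              using sep[OF xQ xQ xx nz[unfolded 2]] by (intro AG) blast
          qed
        qed
        then have "hamming N (w (W i j)) (w (W' i j)) \<le>
            card {t. t < N \<and> 2 * \<theta> \<le> \<bar>noiseless h enc W i t - noiseless h enc W' i t\<bar>}"
          unfolding hamming_def by (intro card_mono) auto
        then show ?thesis using wd[OF msg[OF W(1)] msg[OF W(2)] j] by linarith
      qed
      obtain dec where dec: "X_code N (K * real Q ^ 6) (\<lambda>_ _. r) enc dec"
        and rx: "\<forall>W\<in>messages N (\<lambda>_ _. r). \<forall>i. rx_error h N enc dec i W \<le>
          measure (gauss {..<N}) {z \<in> space (gauss {..<N}). \<not> card {t. t < N \<and> (2 * \<theta>) / 2 \<le> \<bar>z t\<bar>} \<le> ?D}"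
        using separated_code_decoder[of N "\<lambda>_ _. r" enc "K * real Q ^ 6" ?D "2 * \<theta>" h] pw far by blast
      have "rx_error h N enc dec i W \<le> (1 / 2) ^ N" if "W \<in> messages N (\<lambda>_ _. r)" for W i
        using rx[rule_format, OF that, of i] tail[of N] by simp
      then have "error_prob h N (\<lambda>_ _. r) enc dec \<le> 2 * (1 / 2) ^ N" by (intro error_prob_le[OF dec])
      with dec show ?thesis by blast
    qed
    then obtain enc dec where ed: "\<And>N. X_code N (K * real Q ^ 6) (\<lambda>_ _. r) (enc N) (dec N)"
      "\<And>N. error_prob h N (\<lambda>_ _. r) (enc N) (dec N) \<le> 2 * (1 / 2) ^ N" by metis
    have "(\<lambda>N. error_prob h N (\<lambda>_ _. r) (enc N) (dec N)) \<longlonglongrightarrow> 0"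
    proof (rule tendsto_sandwich[OF _ _ tendsto_const])
      show "(\<lambda>N. 2 * (1 / 2 :: real) ^ N) \<longlonglongrightarrow> 0"
        by (intro tendsto_mult_right_zero LIMSEQ_realpow_zero) auto
      show "\<forall>\<^sub>F N in sequentially. 0 \<le> error_prob h N (\<lambda>_ _. r) (enc N) (dec N)"
        by (simp add: error_prob_def)
    qed (simp add: ed(2))
    then have "0 \<le> r \<longrightarrow> achievable h (K * real Q ^ 6) (\<lambda>_ _. r)"
      unfolding achievable_def using ed(1)
      by (auto intro!: exI[of _ "\<lambda>N. N"] exI[of _ enc] exI[of _ dec] filterlim_ident)
    then show ?thesis using Q unfolding r_def by (intro exI[of _ Q]) auto
  qed
  moreover have "0 < K" using A0 H by (simp add: K_def)
  ultimately show ?thesis by blast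
qed

text \<open>A limsup below \<open>4 / 3\<close> would bound the ratio by some
  \<open>c < 4 / 3\<close> at all large powers. The powers \<open>K * Q ^ 6\<close> at good
  \<open>Q\<close> violate this, since the scheme approaches the ratio
  \<open>4 / 3 * (1 - 2 * \<tau>)\<close> there.\<close>

lemma total_dof_ge:
  fixes h :: "real^2^2"
  assumes h: "\<And>i j. 0 < h $ i $ j" and irr: "h $ 1 $ 2 * h $ 2 $ 1 / (h $ 1 $ 1 * h $ 2 $ 2) \<notin> \<rat>"
  shows "ereal (4 / 3) \<le> total_dof h"
proof (rule ccontr)
  assume "\<not> ereal (4 / 3) \<le> total_dof h"
  then obtain c where c: "total_dof h < ereal c" "ereal c < ereal (4 / 3)"
    using ereal_dense2[of "total_dof h" "ereal (4 / 3)"] by (auto simp: not_le)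
  have "\<forall>\<^sub>F P in at_top. sum_capacity h P / ereal (1 / 2 * log 2 P) < ereal c"
    using c(1) unfolding total_dof_def by (rule Limsup_lessD)
  then obtain P0 where P0: "\<And>P. P0 \<le> P \<Longrightarrow> sum_capacity h P / ereal (1 / 2 * log 2 P) < ereal c"
    by (auto simp: eventually_at_top_linorder)
  \<comment> \<open>The loss \<open>8 / 3 * \<tau>\<close> is at most two thirds of the gap
    \<open>4 / 3 - c\<close>, and \<open>\<tau> \<le> 1 / 4\<close> keeps the rate factor
    \<open>1 - 2 * \<tau>\<close> positive.\<close>
  define \<tau> where "\<tau> = min (1 / 4) ((4 / 3 - c) / 4)"
  have "\<tau> \<le> (4 / 3 - c) / 4" unfolding \<tau>_def by (rule min.cobounded2)
  then have \<tau>: "0 < \<tau>" "\<tau> \<le> 1 / 4" "c < 4 / 3 * (1 - 2 * \<tau>)" using c(2) by (auto simp: \<tau>_def)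
  obtain K where K: "0 < K" and ach: "\<And>Q0. \<exists>Q\<ge>Q0. 0 \<le> (1 - 2 * \<tau>) * log 2 (real Q) - 1 \<longrightarrow>
      achievable h (K * real Q ^ 6) (\<lambda>_ _. (1 - 2 * \<tau>) * log 2 (real Q) - 1)"
    using achievable_alignment[OF h irr \<tau>(1)] by blast
  have "((\<lambda>Q. 4 * ((1 - 2 * \<tau>) * log 2 (real Q) - 1) / (1 / 2 * log 2 (K * real Q ^ 6))) \<longlongrightarrow> 4 / 3 * (1 - 2 * \<tau>)) sequentially"
    using K \<tau>(1,2) by real_asymp
  then have 1: "eventually (\<lambda>Q. c < 4 * ((1 - 2 * \<tau>) * log 2 (real Q) - 1) / (1 / 2 * log 2 (K * real Q ^ 6))) sequentially"
    using \<tau>(3) by (rule order_tendstoD)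
  have 2: "eventually (\<lambda>Q. P0 \<le> K * real Q ^ 6) sequentially"
    using K by real_asymp
  have 3: "eventually (\<lambda>Q. 1 < K * real Q ^ 6) sequentially"
    using K by real_asymp
  have "0 < 1 - 2 * \<tau>" using \<tau> by simp
  then have 4: "eventually (\<lambda>Q. 0 \<le> (1 - 2 * \<tau>) * log 2 (real Q) - 1) sequentially"
    by real_asymp
  obtain Q0 where Q0: "\<And>Q. Q0 \<le> Q \<Longrightarrow> c < 4 * ((1 - 2 * \<tau>) * log 2 (real Q) - 1) / (1 / 2 * log 2 (K * real Q ^ 6)) \<and>
      P0 \<le> K * real Q ^ 6 \<and> 1 < K * real Q ^ 6 \<and> 0 \<le> (1 - 2 * \<tau>) * log 2 (real Q) - 1"
    using eventually_conj[OF 1 eventually_conj[OF 2 eventually_conj[OF 3 4]]]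
    by (auto simp: eventually_sequentially)
  obtain Q where Q: "Q0 \<le> Q" "achievable h (K * real Q ^ 6) (\<lambda>_ _. (1 - 2 * \<tau>) * log 2 (real Q) - 1)"
    using ach[of Q0] Q0 by blast
  define P where "P = K * real Q ^ 6"
  define r where "r = (1 - 2 * \<tau>) * log 2 (real Q) - 1"
  have l: "0 < 1 / 2 * log 2 P" using Q0[OF Q(1)] by (simp add: P_def zero_less_log_cancel_iff)
  have "ereal (\<Sum>i\<in>(UNIV :: 2 set). \<Sum>j\<in>(UNIV :: 2 set). r) \<le> sum_capacity h P"
    unfolding sum_capacity_def by (rule SUP_upper2[of "\<lambda>_ _. r"]) (use Q(2) in \<open>auto simp: P_def r_def\<close>)
  then have "ereal (4 * r) \<le> sum_capacity h P" by simp
  then have "ereal (4 * r) / ereal (1 / 2 * log 2 P) \<le> sum_capacity h P / ereal (1 / 2 * log 2 P)"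
    using l by (intro ereal_divide_right_mono) auto
  also have "\<dots> < ereal c" using P0 Q0[OF Q(1)] by (simp only: P_def)
  finally have "ereal (4 * r) / ereal (1 / 2 * log 2 P) < ereal c" .
  moreover have "1 / 2 * log 2 P \<noteq> 0" using l by simp
  ultimately have "4 * r / (1 / 2 * log 2 P) < c" by (simp only: ereal_divide if_False less_ereal.simps)
  then show False using Q0[OF Q(1)] unfolding P_def r_def by linarith
qed

theorem theorem10:
  shows "\<exists>E :: (real^2^2) set.
    E \<subseteq> {h. \<forall>i j. 0 < h $ i $ j} \<and>
    hausdorff_dim E \<le> ereal (4 - 1 / 3) \<and>
    (\<forall>h \<in> {h. \<forall>i j. 0 < h $ i $ j} - E. total_dof h = ereal (4 / 3))"
proof (intro exI conjI ballI)
  show "rational_ratio_set \<subseteq> {h. \<forall>i j. 0 < h $ i $ j}" by (auto simp: rational_ratio_set_def)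
  show "hausdorff_dim rational_ratio_set \<le> ereal (4 - 1 / 3)" by (rule hausdorff_dim_rational_ratio_set)
  fix h :: "real^2^2" assume "h \<in> {h. \<forall>i j. 0 < h $ i $ j} - rational_ratio_set"
  then have "\<And>i j. 0 < h $ i $ j" "h $ 1 $ 2 * h $ 2 $ 1 / (h $ 1 $ 1 * h $ 2 $ 2) \<notin> \<rat>"
    by (auto simp: rational_ratio_set_def)
  then show "total_dof h = ereal (4 / 3)" by (intro antisym total_dof_le total_dof_ge)
qed

end
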